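(* Assume the setting below and suppose every coordinate of the saddle point is critical, i.e. $\zeta_j=1$ for every $j\in\mathcal{A}$. Then \[ \lim_{n\to+\infty}\mathbb{P}(m \text{ is an } \boldsymbol{\alpha}\text{-winner}) = \frac{1}{\sqrt{(2\pi)^{m-1}\det(\mathcal{H}_K(\boldsymbol{\tau}))}}\int_{(0,+\infty)^{m-1}} e^{-\mathbf{u}^T\mathcal{H}_K(\boldsymbol{\tau})^{-1}\mathbf{u}/2}\,d\mathbf{u}. \]
   Context: Fix an integer $m\ge 2$ of candidates $\{1,\dots,m\}$ and let $\mathcal{A}=\{1,\dots,m-1\}$. There are $n$ voters; each voter independently draws a strict ranking $r$ of the candidates with probability $p_r$, where $p_r>0$ for each of the $m!$ rankings and $\sum_r p_r=1$ (independent of $n$). For $\mathcal{X}\subseteq\mathcal{A}$, let $p_{\mathcal{X}}$ be the probability that, in a random ranking, the set of adversaries ranked above $m$ is exactly $\mathcal{X}$; let $P(\mathbf{x})=\sum_{\mathcal{X}\subseteq\mathcal{A}} p_{\mathcal{X}}\prod_{j\in\mathcal{X}}x_j$. Fix $\boldsymbol{\alpha}\in(0,1)^{m-1}$, $\boldsymbol{\beta}=\mathbf{1}-\boldsymbol{\alpha}$. Candidate $m$ is an $\boldsymbol{\alpha}$-winner if for every $j\in\mathcal{A}$, strictly more than $\alpha_j n$ voters rank $m$ above $j$. Let $K(\mathbf{t})=\log P(e^{t_1},\dots,e^{t_{m-1}})$; $\boldsymbol{\tau}$ is the unique maximizer over $\mathbb{R}^{m-1}$ of $-K(\mathbf{t})+\boldsymbol{\beta}^T\mathbf{t}$,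 $\boldsymbol{\zeta}=e^{\boldsymbol{\tau}}$ componentwise, and $\mathcal{H}_K(\boldsymbol{\tau})$ is the Hessian of $K$ at $\boldsymbol{\tau}$. *)

theory Defs
  imports "HOL-Analysis.Analysis"
begin

text \<open>Setting. The adversaries form a finite type 'n (so m - 1 = CARD('n) \<ge> 1);
the candidates are 'n option, where None plays the role of candidate m and
Some j the adversary j. A strict ranking is a position function
r :: 'n option \<Rightarrow> nat which is a bijection onto {0..<m}; position 0 is the top.\<close>

definition rankings :: "('n::finite option \<Rightarrow> nat) set" where
  "rankings = {r. bij_betw r UNIV {..<CARD('n option)}}"

definition above_m :: "('n::finite option \<Rightarrow> nat) \<Rightarrow> 'n set" where
  "above_m r = {j. r (Some j) < r None}"

definition pX :: "(('n::finite option \<Rightarrow> nat) \<Rightarrow> real) \<Rightarrow> 'n set \<Rightarrow> real" where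
  "pX p X = (\<Sum>r\<in>{r\<in>rankings. above_m r = X}. p r)"

definition Ppoly :: "(('n::finite option \<Rightarrow> nat) \<Rightarrow> real) \<Rightarrow> real^'n \<Rightarrow> real" where
  "Ppoly p x = (\<Sum>X\<in>(UNIV :: 'n set set). pX p X * (\<Prod>j\<in>X. x $ j))"

definition Kfun :: "(('n::finite option \<Rightarrow> nat) \<Rightarrow> real) \<Rightarrow> real^'n \<Rightarrow> real" where
  "Kfun p t = ln (Ppoly p (\<chi> j. exp (t $ j)))"

definition saddle_obj :: "(('n::finite option \<Rightarrow> nat) \<Rightarrow> real) \<Rightarrow> real^'n \<Rightarrow> real^'n \<Rightarrow> real" where
  "saddle_obj p \<alpha> t = - Kfun p t + (\<chi> j. 1 - \<alpha> $ j) \<bullet> t"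

definition tau :: "(('n::finite option \<Rightarrow> nat) \<Rightarrow> real) \<Rightarrow> real^'n \<Rightarrow> real^'n" where
  "tau p \<alpha> = (THE t. \<forall>s. saddle_obj p \<alpha> s \<le> saddle_obj p \<alpha> t)"

definition zeta :: "(('n::finite option \<Rightarrow> nat) \<Rightarrow> real) \<Rightarrow> real^'n \<Rightarrow> real^'n" where
  "zeta p \<alpha> = (\<chi> j. exp (tau p \<alpha> $ j))"

definition partial_deriv :: "'n::finite \<Rightarrow> (real^'n \<Rightarrow> real) \<Rightarrow> real^'n \<Rightarrow> real" where
  "partial_deriv i f t = deriv (\<lambda>h. f (t + h *\<^sub>R axis i 1)) 0"

definition hessian :: "(real^'n::finite \<Rightarrow> real) \<Rightarrow> real^'n \<Rightarrow> real^'n^'n" where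
  "hessian f t = (\<chi> i j. partial_deriv i (partial_deriv j f) t)"

definition alpha_winner :: "real^'n::finite \<Rightarrow> nat \<Rightarrow> (nat \<Rightarrow> ('n option \<Rightarrow> nat)) \<Rightarrow> bool" where
  "alpha_winner \<alpha> n v \<longleftrightarrow>
     (\<forall>j. real (card {i\<in>{..<n}. v i None < v i (Some j)}) > \<alpha> $ j * real n)"

definition prob_winner :: "(('n::finite option \<Rightarrow> nat) \<Rightarrow> real) \<Rightarrow> real^'n \<Rightarrow> nat \<Rightarrow> real" where
  "prob_winner p \<alpha> n =
     (\<Sum>v\<in>PiE {..<n} (\<lambda>_. rankings).
        (\<Prod>i<n. p (v i)) * (if alpha_winner \<alpha> n v then 1 else 0))"

end

theory Submission
  imports Defs "HOL-Probability.Probability" "HOL-Real_Asymp.Real_Asymp"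
begin

text \<open>Criticality forces the saddle point to be \<open>0\<close>, and the vanishing gradient there says that
  \<open>\<beta>\<close> is the mean of the vector of indicators ``adversary \<open>j\<close> is ranked above \<open>m\<close>'',
  while the Hessian is its covariance matrix. Candidate \<open>m\<close> wins exactly when the centred and
  sign-reversed sum of these vectors lies in the open positive orthant, so the claim is the multivariate
  central limit theorem for that orthant. Expectations of trigonometric polynomials converge because
  the characteristic functions do; Stone--Weierstrass extends this to continuous functions of
  \<open>(sin (s x\<^sub>j))\<^sub>j\<close>, and with small \<open>s\<close> such functions squeeze the indicator of the orthant
  up to an exponential-moment tail bound. The limiting Gaussian vector is written as \<open>A v\<close> with
  \<open>v\<close> standard and \<open>H = A A\<^sup>T\<close>, and a linear change of variables produces the density.\<close>

section \<open>Linear change of variables for Lebesgue measure\<close>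

text \<open>The orthant indicator is neither continuous nor periodic, whereas characteristic
  functions control only trigonometric polynomials of the normalized sum. Each cutoff is therefore a
  continuous function of the sines of the coordinates divided by \<open>k\<close>, which causes two
  errors. Periodicity spoils the comparison outside the window
  \<open>\<bar>x $ j\<bar> \<le> k\<close>; this costs at most a multiple of
  \<open>exp (- k)\<close>, uniformly in the number of voters, so \<open>k\<close> can be fixed
  before that number grows. The cutoffs also blur the faces of the orthant; this error vanishes as
  \<open>k\<close> grows because a nonsingular Gaussian vector puts no mass there. Positivity of all
  ranking probabilities enters because every set of adversaries is the set above \<open>m\<close> in
  some ranking: that makes the saddle objective coercive, its maximizer unique and the covariance
  matrix positive definite. Existence and uniqueness are part of the argument since
  \<open>tau\<close> is a definite description, about which nothing is known before.\<close>

lemma nn_integral_lborel_shear: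
  fixes f :: "'a::euclidean_space \<Rightarrow> ennreal" and \<phi> :: "'a \<Rightarrow> real"
  assumes [measurable]: "f \<in> borel_measurable borel" "\<phi> \<in> borel_measurable borel"
    and i: "i \<in> Basis" and inv: "\<And>x c. \<phi> (x + c *\<^sub>R i) = \<phi> x"
  shows "(\<integral>\<^sup>+x. f (x + \<phi> x *\<^sub>R i) \<partial>lborel) = (\<integral>\<^sup>+x. f x \<partial>lborel)"
proof -
  interpret product_sigma_finite "\<lambda>_::'a. lborel :: real measure" ..
  let ?I = "Basis - {i} :: 'a set"
  let ?s = "\<lambda>\<omega>. \<Sum>b\<in>?I. \<omega> b *\<^sub>R b"
  have B: "Basis = insert i ?I" using i by auto
  have split: "(\<integral>\<^sup>+x. g x \<partial>lborel) =
      (\<integral>\<^sup>+\<omega>. (\<integral>\<^sup>+y. g (?s \<omega> + y *\<^sub>R i) \<partial>lborel) \<partial>(\<Pi>\<^sub>M b\<in>?I. lborel))"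
    if [measurable]: "g \<in> borel_measurable borel" for g :: "'a \<Rightarrow> ennreal"
  proof -
    have "(\<integral>\<^sup>+x. g x \<partial>lborel) = (\<integral>\<^sup>+\<omega>. g (\<Sum>b\<in>Basis. \<omega> b *\<^sub>R b) \<partial>(\<Pi>\<^sub>M b\<in>Basis. lborel))"
      by (subst lborel_eq) (simp add: nn_integral_distr)
    also have "\<dots> = (\<integral>\<^sup>+\<omega>. g (\<Sum>b\<in>insert i ?I. \<omega> b *\<^sub>R b) \<partial>(\<Pi>\<^sub>M b\<in>insert i ?I. lborel))"
      by (simp only: B [symmetric])
    also have "\<dots> = (\<integral>\<^sup>+\<omega>. (\<integral>\<^sup>+y. g (\<Sum>b\<in>insert i ?I. fun_upd \<omega> i y b *\<^sub>R b) \<partial>lborel) \<partial>(\<Pi>\<^sub>M b\<in>?I. lborel))"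
      by (subst product_nn_integral_insert) auto
    also have "\<dots> = (\<integral>\<^sup>+\<omega>. (\<integral>\<^sup>+y. g (?s \<omega> + y *\<^sub>R i) \<partial>lborel) \<partial>(\<Pi>\<^sub>M b\<in>?I. lborel))"
    proof -
      have "(\<Sum>b\<in>insert i ?I. fun_upd \<omega> i y b *\<^sub>R b) = ?s \<omega> + y *\<^sub>R i" for \<omega> y
        by (subst sum.insert) (auto simp: add.commute intro!: sum.cong)
      then show ?thesis by (simp only:)
    qed
    finally show ?thesis .
  qed
  \<comment> \<open>By \<open>inv\<close>, the shift \<open>\<phi>\<close> is constant on each line
    parallel to \<open>i\<close>, so translation invariance of one-dimensional Lebesgue measure
    applies line by line.\<close>
  have "(\<integral>\<^sup>+y. f (s + y *\<^sub>R i + \<phi> (s + y *\<^sub>R i) *\<^sub>R i) \<partial>lborel) = (\<integral>\<^sup>+y. f (s + y *\<^sub>R i) \<partial>lborel)" for s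
    by (subst nn_integral_real_affine [where c = 1 and t = "\<phi> s" and f = "\<lambda>y. f (s + y *\<^sub>R i)"])
       (auto simp: inv algebra_simps)
  then show ?thesis
    by (simp add: split)
qed

lemma prod_Basis_vec:
  "(\<Prod>b\<in>Basis. f b) = (\<Prod>i\<in>UNIV. f (axis i (1::real)))" for f :: "real^'n \<Rightarrow> 'b::comm_monoid_mult"
proof -
  have "Basis = range (\<lambda>i. axis i (1::real) :: real^'n)"
    by (auto simp: Basis_vec_def)
  moreover have "inj (\<lambda>i. axis i (1::real) :: real^'n)"
    by (simp add: inj_on_def axis_eq_axis)
  ultimately have "prod f Basis = prod (f \<circ> (\<lambda>i. axis i 1)) UNIV"
    by (metis prod.reindex)
  then show ?thesis by (simp add: o_def)
qed

lemma lborel_permute_coordinates: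
  fixes \<pi> :: "'n::finite \<Rightarrow> 'n"
  assumes "bij \<pi>"
  shows "distr lborel borel (\<lambda>x::real^'n. \<chi> i. x $ \<pi> i) = lborel"
proof (rule lborel_eqI [symmetric])
  let ?T = "\<lambda>x::real^'n. \<chi> i. x $ \<pi> i"
  have [measurable]: "?T \<in> borel_measurable borel"
    by (intro borel_measurable_continuous_onI continuous_intros)
  fix l u :: "real^'n" assume le: "\<And>b. b \<in> Basis \<Longrightarrow> l \<bullet> b \<le> u \<bullet> b"
  have le': "l $ i \<le> u $ i" for i
    using le [of "axis i 1"] by (simp add: inner_axis)
  let ?S = "\<lambda>x::real^'n. \<chi> i. x $ inv \<pi> i"
  have eq: "?T -` box l u = box (?S l) (?S u)"
    using assms by (auto simp: mem_box_cart) (metis bij_inv_eq_iff)+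
  have "?S l \<bullet> b \<le> ?S u \<bullet> b" if "b \<in> Basis" for b
    using that le' by (auto simp: Basis_vec_def inner_axis)
  then have "emeasure lborel (box (?S l) (?S u)) = (\<Prod>b\<in>Basis. (?S u - ?S l) \<bullet> b)"
    by (simp add: emeasure_lborel_box_eq)
  also have "(\<Prod>b\<in>Basis. (?S u - ?S l) \<bullet> b) = (\<Prod>i\<in>UNIV. (u - l) $ inv \<pi> i)"
    by (simp add: prod_Basis_vec inner_axis)
  also have "\<dots> = (\<Prod>i\<in>UNIV. (u - l) $ i)"
    using prod.reindex_bij_betw [OF bij_imp_bij_inv [OF assms], of "\<lambda>i. (u - l) $ i"] by simp
  also have "\<dots> = (\<Prod>b\<in>Basis. (u - l) \<bullet> b)"
    by (simp add: prod_Basis_vec inner_axis)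
  finally show "emeasure (distr lborel borel ?T) (box l u) = (\<Prod>b\<in>Basis. (u - l) \<bullet> b)"
    by (simp add: emeasure_distr eq)
qed simp

text \<open>The claim is multiplicative in \<open>A\<close>, so elementary matrices suffice:
  diagonal ones rescale the axes, swaps permute coordinates, and adding a multiple of one row to
  another is a shear. Matrices with a zero row satisfy the induction predicate vacuously, since it
  is guarded by a nonzero determinant.\<close>

proposition nn_integral_lborel_linear:
  fixes A :: "real^'n^'n" and f :: "real^'n \<Rightarrow> ennreal"
  assumes "det A \<noteq> 0" "f \<in> borel_measurable borel"
  shows "(\<integral>\<^sup>+u. f u \<partial>lborel) = ennreal \<bar>det A\<bar> * (\<integral>\<^sup>+v. f (A *v v) \<partial>lborel)"
proof -
  have meas [measurable]: "(*v) B \<in> borel_measurable borel" for B :: "real^'n^'n"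
    by (intro borel_measurable_continuous_onI linear_continuous_on) simp
  define P where "P = (\<lambda>A :: real^'n^'n. det A \<noteq> 0 \<longrightarrow> (\<forall>f::real^'n \<Rightarrow> ennreal. f \<in> borel_measurable borel \<longrightarrow>
     (\<integral>\<^sup>+u. f u \<partial>lborel) = ennreal \<bar>det A\<bar> * (\<integral>\<^sup>+v. f (A *v v) \<partial>lborel)))"
  have PD: "(\<integral>\<^sup>+u. f u \<partial>lborel) = ennreal \<bar>det B\<bar> * (\<integral>\<^sup>+v. f (B *v v) \<partial>lborel)"
    if "P B" "det B \<noteq> 0" "f \<in> borel_measurable borel" for B and f :: "real^'n \<Rightarrow> ennreal"
    using that unfolding P_def by blast
  have PI: "P B" if "\<bar>det B\<bar> = 1"
      "\<And>f::real^'n \<Rightarrow> ennreal. f \<in> borel_measurable borel \<Longrightarrow> (\<integral>\<^sup>+u. f u \<partial>lborel) = (\<integral>\<^sup>+v. f (B *v v) \<partial>lborel)" for B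
    unfolding P_def
  proof (intro impI allI)
    fix f :: "real^'n \<Rightarrow> ennreal" assume "f \<in> borel_measurable borel"
    from that(2) [OF this] that(1)
    show "(\<integral>\<^sup>+u. f u \<partial>lborel) = ennreal \<bar>det B\<bar> * (\<integral>\<^sup>+v. f (B *v v) \<partial>lborel)" by simp
  qed
  have "P A"
  proof (rule induct_matrix_elementary [of P])
    fix A B assume AB: "P A" "P B"
    show "P (A ** B)"
      unfolding P_def
    proof (intro impI allI)
      fix f :: "real^'n \<Rightarrow> ennreal"
      assume d: "det (A ** B) \<noteq> 0" and [measurable]: "f \<in> borel_measurable borel"
      from d have dd: "det A \<noteq> 0" "det B \<noteq> 0" by (auto simp: det_mul)
      have "(\<integral>\<^sup>+u. f u \<partial>lborel) = ennreal \<bar>det A\<bar> * (\<integral>\<^sup>+v. f (A *v v) \<partial>lborel)"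
        using AB(1) dd by (intro PD) auto
      also have "(\<integral>\<^sup>+v. f (A *v v) \<partial>lborel) = ennreal \<bar>det B\<bar> * (\<integral>\<^sup>+v. f (A *v (B *v v)) \<partial>lborel)"
        using AB(2) dd by (intro PD) auto
      finally show "(\<integral>\<^sup>+u. f u \<partial>lborel) = ennreal \<bar>det (A ** B)\<bar> * (\<integral>\<^sup>+v. f (A ** B *v v) \<partial>lborel)"
        by (simp add: det_mul abs_mult ennreal_mult mult.assoc matrix_vector_mul_assoc)
    qed
  next
    fix A :: "real^'n^'n" and i assume "row i A = 0"
    then show "P A" by (auto simp: P_def dest: det_zero_row)
  next
    fix A :: "real^'n^'n" assume diag: "\<And>i j. i \<noteq> j \<Longrightarrow> A $ i $ j = 0"
    show "P A"
      unfolding P_def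
    proof (intro impI allI)
      fix f :: "real^'n \<Rightarrow> ennreal"
      assume d: "det A \<noteq> 0" and [measurable]: "f \<in> borel_measurable borel"
      have det: "det A = (\<Prod>i\<in>UNIV. A $ i $ i)" by (rule det_diagonal) (rule diag)
      \<comment> \<open>\<open>lborel_affine_euclidean\<close> takes scaling factors indexed by
        basis vectors rather than by indices; \<open>c\<close> reads the diagonal entry off the
        vector \<open>axis i 1\<close>.\<close>
      define c where "c = (\<lambda>b::real^'n. \<Sum>i\<in>UNIV. b $ i * A $ i $ i)"
      have c_axis: "c (axis i 1) = A $ i $ i" for i
        by (simp add: c_def axis_def if_distrib [of "\<lambda>x. x * _"] cong: if_cong)
      have c: "c j \<noteq> 0" if "j \<in> Basis" for j
        using that d by (auto simp: Basis_vec_def c_axis det)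
      have T: "0 + (\<Sum>j\<in>Basis. (c j * (x \<bullet> j)) *\<^sub>R j) = A *v x" for x
      proof (subst vec_eq_iff, intro allI)
        fix k
        have "(0 + (\<Sum>j\<in>Basis. (c j * (x \<bullet> j)) *\<^sub>R j)) $ k = c (axis k 1) * (x \<bullet> axis k 1)"
          by (simp add: cart_eq_inner_axis inner_sum_left inner_Basis if_distrib sum.delta' cong: if_cong)
        also have "\<dots> = (\<Sum>j\<in>UNIV. if j = k then A $ k $ k * x $ k else 0)"
          by (simp add: c_axis inner_axis)
        also have "\<dots> = (A *v x) $ k"
          unfolding matrix_vector_mult_def vec_lambda_beta by (rule sum.cong) (auto simp: diag)
        finally show "(0 + (\<Sum>j\<in>Basis. (c j * (x \<bullet> j)) *\<^sub>R j)) $ k = (A *v x) $ k" .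
      qed
      have det': "(\<Prod>j\<in>Basis. \<bar>c j\<bar>) = \<bar>det A\<bar>"
        by (simp add: det prod_Basis_vec c_axis abs_prod)
      have "(lborel :: (real^'n) measure) = density (distr lborel borel ((*v) A)) (\<lambda>_. ennreal \<bar>det A\<bar>)"
        using lborel_affine_euclidean [of c 0, OF c] by (simp only: T det')
      then have "(\<integral>\<^sup>+u. f u \<partial>lborel) = (\<integral>\<^sup>+u. f u \<partial>density (distr lborel borel ((*v) A)) (\<lambda>_. ennreal \<bar>det A\<bar>))"
        by simp
      then show "(\<integral>\<^sup>+u. f u \<partial>lborel) = ennreal \<bar>det A\<bar> * (\<integral>\<^sup>+v. f (A *v v) \<partial>lborel)"
        by (simp add: nn_integral_density nn_integral_distr nn_integral_cmult)
    qed
  next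
    fix m n :: 'n assume "m \<noteq> n"
    let ?\<pi> = "Transposition.transpose m n"
    let ?A = "\<chi> i j. mat 1 $ i $ ?\<pi> j :: real^'n^'n"
    have "det ?A = of_int (sign ?\<pi>) * det (mat 1 :: real^'n^'n)"
      by (rule det_permute_columns) (simp add: permutes_swap_id)
    then have det: "\<bar>det ?A\<bar> = 1" by (simp add: abs_mult sign_def)
    have mul: "?A *v x = (\<chi> i. x $ ?\<pi> i)" for x
    proof -
      have "(\<Sum>j\<in>UNIV. mat 1 $ i $ ?\<pi> j * x $ j) = (\<Sum>j\<in>UNIV. if j = ?\<pi> i then x $ j else 0)" for i
        by (rule sum.cong) (auto simp: mat_def)
      then show ?thesis by (simp add: vec_eq_iff matrix_vector_mult_def)
    qed
    have "(\<integral>\<^sup>+u. f u \<partial>lborel) = (\<integral>\<^sup>+v. f (?A *v v) \<partial>lborel)"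
      if "f \<in> borel_measurable borel" for f :: "real^'n \<Rightarrow> ennreal"
      using that meas [of ?A] unfolding mul
      by (subst lborel_permute_coordinates [of ?\<pi>, symmetric]) (simp_all add: nn_integral_distr)
    show "P ?A" by (rule PI) (use det in simp, fact)
  next
    fix m n :: 'n and c :: real assume mn: "m \<noteq> n"
    let ?A = "\<chi> i j. if i = m \<and> j = n then c else of_bool (i = j) :: real^'n^'n"
    have "?A = (\<chi> k. if k = m then row m (mat 1) + c *s row n (mat 1) else row k (mat 1))"
      using mn by (auto simp: vec_eq_iff row_def mat_def)
    then have det: "det ?A = 1" using det_row_operation [OF mn, of "mat 1" c] by simp
    have mul: "?A *v x = x + (c * x $ n) *\<^sub>R axis m 1" for x
    proof (subst vec_eq_iff, intro allI)
      fix i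
      have "(?A *v x) $ i = (\<Sum>j\<in>UNIV. (if j = i then x $ j else 0) + (if j = n then (if i = m then c * x $ j else 0) else 0))"
        unfolding matrix_vector_mult_def using mn by (auto intro!: sum.cong)
      also have "\<dots> = (x + (c * x $ n) *\<^sub>R axis m 1) $ i"
        by (simp add: sum.distrib axis_def)
      finally show "(?A *v x) $ i = (x + (c * x $ n) *\<^sub>R axis m 1) $ i" .
    qed
    have "(\<integral>\<^sup>+u. f u \<partial>lborel) = (\<integral>\<^sup>+v. f (?A *v v) \<partial>lborel)"
      if "f \<in> borel_measurable borel" for f :: "real^'n \<Rightarrow> ennreal"
    proof -
      have "axis m (1::real) $ n = 0" using mn by (simp add: axis_def)
      then show ?thesis
        unfolding mul using that
        by (subst nn_integral_lborel_shear [where \<phi> = "\<lambda>x. c * x $ n"]) (auto simp: Basis_vec_def)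
    qed
    show "P ?A" by (rule PI) (use det in simp, fact)
  qed
  with assms show ?thesis by (intro PD)
qed

section \<open>Gaussian vectors\<close>

text \<open>The product form lets integrals factor over the coordinates;
  \<open>prod_std_normal_density\<close> recovers the radial form for the change of
  variables.\<close>

definition std_gaussian :: "'a::euclidean_space measure" where
  "std_gaussian = density lborel (\<lambda>v. ennreal (\<Prod>b\<in>Basis. std_normal_density (v \<bullet> b)))"

lemma sets_std_gaussian [measurable_cong, simp]: "sets std_gaussian = sets borel"
  and space_std_gaussian [simp]: "space std_gaussian = UNIV"
  by (simp_all add: std_gaussian_def)

lemma prod_std_normal_density:
  fixes v :: "'a::euclidean_space"
  shows "(\<Prod>b\<in>Basis. std_normal_density (v \<bullet> b)) = exp (- (v \<bullet> v) / 2) / sqrt ((2 * pi) ^ DIM('a))"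
proof -
  have "(\<Prod>b\<in>Basis. std_normal_density (v \<bullet> b))
      = (\<Prod>b\<in>(Basis :: 'a set). 1 / sqrt (2 * pi)) * (\<Prod>b\<in>Basis. exp (- (v \<bullet> b)\<^sup>2 / 2))"
    by (simp only: std_normal_density_def prod.distrib)
  also have "(\<Prod>b\<in>Basis. exp (- (v \<bullet> b)\<^sup>2 / 2)) = exp (- (v \<bullet> v) / 2)"
    by (simp add: exp_sum [symmetric] euclidean_inner [of v v] power2_eq_square sum_negf sum_divide_distrib)
  finally show ?thesis
    unfolding real_sqrt_power by (simp add: power_one_over)
qed

lemma prob_space_std_gaussian: "prob_space (std_gaussian :: 'a::euclidean_space measure)"
proof
  have "emeasure (std_gaussian :: 'a measure) UNIV = (\<integral>\<^sup>+v. ennreal (\<Prod>b\<in>Basis. std_normal_density ((v::'a) \<bullet> b)) \<partial>lborel)"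
    by (simp add: std_gaussian_def emeasure_density)
  also have "\<dots> = (\<integral>\<^sup>+v. (\<Prod>b\<in>Basis. ennreal (std_normal_density ((v::'a) \<bullet> b))) \<partial>lborel)"
    by (simp add: prod_ennreal)
  also have "\<dots> = (\<Prod>b\<in>(Basis :: 'a set). (\<integral>\<^sup>+x. ennreal (std_normal_density x) \<partial>lborel))"
    by (rule nn_integral_lborel_prod) auto
  also have "(\<integral>\<^sup>+x. ennreal (std_normal_density x) \<partial>lborel) = 1"
    using prob_space.emeasure_space_1 [OF prob_space_normal_density [of 1 0]]
    by (simp add: emeasure_density)
  finally show "emeasure (std_gaussian :: 'a measure) (space std_gaussian) = 1"
    by simp
qed

text \<open>Density and character both factor over the coordinates, so Fubini reduces the claim to
  the one-dimensional characteristic function.\<close>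

lemma char_std_gaussian:
  fixes c :: "'a::euclidean_space"
  shows "(\<integral>v. cis (c \<bullet> v) \<partial>std_gaussian) = of_real (exp (- (c \<bullet> c) / 2))"
proof -
  interpret product_sigma_finite "\<lambda>_::'a. lborel :: real measure" ..
  have cis_sum: "cis (\<Sum>b\<in>B. g b) = (\<Prod>b\<in>B. cis (g b))" if "finite B" for B and g :: "'a \<Rightarrow> real"
    using that by induction (auto simp: cis_mult [symmetric])
  have [measurable]: "cis \<in> borel_measurable borel"
    by (intro borel_measurable_continuous_onI continuous_intros)
  let ?F = "\<lambda>b x. std_normal_density x *\<^sub>R cis ((c \<bullet> b) * x)"
  have int: "integrable lborel (?F b)" for b
    by (rule Bochner_Integration.integrable_bound [OF integrable_normal_density [of 1 0]]) auto
  have char: "(\<integral>x. ?F b x \<partial>lborel) = of_real (exp (- (c \<bullet> b)\<^sup>2 / 2))" for b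
  proof -
    have "(\<integral>x. ?F b x \<partial>lborel) = char std_normal_distribution (c \<bullet> b)"
      by (simp add: char_def integral_density cis_conv_exp)
    then show ?thesis by (simp add: char_std_normal_distribution)
  qed
  have "(\<integral>v. cis (c \<bullet> v) \<partial>std_gaussian) =
      (\<integral>v. (\<Prod>b\<in>Basis. std_normal_density (v \<bullet> b)) *\<^sub>R cis (c \<bullet> v) \<partial>lborel)"
    by (simp add: std_gaussian_def integral_density prod_nonneg)
  also have "\<dots> = (\<integral>v. (\<Prod>b\<in>Basis. ?F b (v \<bullet> b)) \<partial>lborel)"
  proof -
    have "cis (c \<bullet> v) = (\<Prod>b\<in>Basis. cis ((c \<bullet> b) * (v \<bullet> b)))" for v
      by (simp add: euclidean_inner [of c v] cis_sum)
    then show ?thesis by (simp add: scaleR_conv_of_real prod.distrib)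
  qed
  also have "\<dots> = (\<integral>\<omega>. (\<Prod>b\<in>Basis. ?F b ((\<Sum>b\<in>Basis. \<omega> b *\<^sub>R b) \<bullet> b)) \<partial>(\<Pi>\<^sub>M b\<in>Basis. lborel))"
    by (subst lborel_eq) (simp add: integral_distr)
  also have "\<dots> = (\<integral>\<omega>. (\<Prod>b\<in>Basis. ?F b (\<omega> b)) \<partial>(\<Pi>\<^sub>M b\<in>Basis. lborel))"
    by (intro Bochner_Integration.integral_cong prod.cong refl) simp
  also have "\<dots> = (\<Prod>b\<in>Basis. of_real (exp (- (c \<bullet> b)\<^sup>2 / 2)))"
    by (subst product_integral_prod) (auto simp: int char)
  also have "\<dots> = of_real (exp (\<Sum>b\<in>Basis. - (c \<bullet> b)\<^sup>2 / 2))"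
    by (simp add: exp_sum)
  also have "(\<Sum>b\<in>Basis. - (c \<bullet> b)\<^sup>2 / 2) = - (c \<bullet> c) / 2"
    by (simp add: euclidean_inner [of c c] power2_eq_square sum_negf sum_divide_distrib)
  finally show ?thesis .
qed

text \<open>Substitute \<open>u = A *v v\<close>: the quadratic form of the inverse of
  \<open>H\<close> at \<open>A *v v\<close> is \<open>v \<bullet> v\<close>, and the Jacobian
  \<open>\<bar>det A\<bar>\<close> is the square root of \<open>det H\<close>.\<close>

proposition std_gaussian_linear_image:
  fixes A :: "real^'n^'n"
  defines "H \<equiv> A ** transpose A"
  assumes A: "det A \<noteq> 0" and S [measurable]: "S \<in> sets borel"
  shows "measure std_gaussian {v. A *v v \<in> S} =
    1 / sqrt ((2 * pi) ^ CARD('n) * det H) * (LINT u:S|lborel. exp (- (u \<bullet> (matrix_inv H *v u)) / 2))"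
proof -
  have [measurable]: "(*v) B \<in> borel_measurable borel" for B :: "real^'n^'n"
    by (intro borel_measurable_continuous_onI linear_continuous_on) simp
  let ?d = "sqrt ((2 * pi) ^ CARD('n))"
  let ?f = "\<lambda>u. indicator S u * exp (- (u \<bullet> (matrix_inv H *v u)) / 2) :: real"
  have detH: "det H = (det A)\<^sup>2"
    by (simp add: H_def det_mul det_transpose power2_eq_square)
  have invH: "matrix_inv H ** H = mat 1"
  proof -
    have "\<exists>B. H ** B = mat 1 \<and> B ** H = mat 1"
      using A detH invertible_det_nz [of H] unfolding invertible_def by simp
    from someI_ex [OF this] show ?thesis by (simp add: matrix_inv_def)
  qed
  have quad: "(A *v v) \<bullet> (matrix_inv H *v (A *v v)) = v \<bullet> v" for v
  proof -
    have "transpose A ** (matrix_inv H ** A) = mat 1"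
    proof -
      have "(matrix_inv H ** A) ** transpose A = mat 1"
        using invH by (simp add: H_def matrix_mul_assoc)
      then show ?thesis using matrix_left_right_inverse by blast
    qed
    then have *: "transpose A *v (matrix_inv H *v (A *v v)) = v"
      by (simp add: matrix_vector_mul_assoc matrix_mul_assoc)
    have "(A *v v) \<bullet> (matrix_inv H *v (A *v v)) = (matrix_inv H *v (A *v v)) \<bullet> (A *v v)"
      by (rule inner_commute)
    also have "\<dots> = (transpose A *v (matrix_inv H *v (A *v v))) \<bullet> v"
      by (simp only: transpose_matrix_vector dot_lmul_matrix)
    finally show ?thesis by (simp only: *)
  qed
  have eq: "emeasure std_gaussian {v. A *v v \<in> S} = ennreal (1 / (?d * \<bar>det A\<bar>)) * (\<integral>\<^sup>+u. ennreal (?f u) \<partial>lborel)"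
  proof -
    have [measurable]: "?f \<in> borel_measurable borel" by measurable
    have "emeasure std_gaussian {v. A *v v \<in> S} =
        (\<integral>\<^sup>+v. ennreal (exp (- (v \<bullet> v) / 2) / ?d) * indicator {v. A *v v \<in> S} v \<partial>lborel)"
      by (simp add: std_gaussian_def emeasure_density prod_std_normal_density)
    also have "\<dots> = (\<integral>\<^sup>+v. ennreal (1 / ?d) * ennreal (?f (A *v v)) \<partial>lborel)"
      by (intro nn_integral_cong) (auto simp: quad ennreal_mult'[symmetric] indicator_def)
    also have "\<dots> = ennreal (1 / ?d) * (\<integral>\<^sup>+v. ennreal (?f (A *v v)) \<partial>lborel)"
      by (intro nn_integral_cmult) measurable
    also have "ennreal (1 / ?d) = ennreal (1 / (?d * \<bar>det A\<bar>)) * ennreal \<bar>det A\<bar>"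
      using A by (simp add: ennreal_mult'[symmetric])
    also have "\<dots> * (\<integral>\<^sup>+v. ennreal (?f (A *v v)) \<partial>lborel) =
        ennreal (1 / (?d * \<bar>det A\<bar>)) * (\<integral>\<^sup>+u. ennreal (?f u) \<partial>lborel)"
      by (subst nn_integral_lborel_linear [OF A]) (auto simp: mult.assoc)
    finally show ?thesis .
  qed
  \<comment> \<open>The integrand is nonnegative, so both sides can be read off the same extended
    integral by \<open>enn2real\<close>, and its finiteness never has to be discussed.\<close>
  have "(LINT u:S|lborel. exp (- (u \<bullet> (matrix_inv H *v u)) / 2)) = enn2real (\<integral>\<^sup>+u. ennreal (?f u) \<partial>lborel)"
    unfolding set_lebesgue_integral_def by (subst integral_eq_nn_integral) auto
  moreover have "measure std_gaussian {v. A *v v \<in> S} = 1 / (?d * \<bar>det A\<bar>) * enn2real (\<integral>\<^sup>+u. ennreal (?f u) \<partial>lborel)"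
    by (simp add: measure_def eq enn2real_mult)
  ultimately show ?thesis
    by (simp add: detH real_sqrt_mult)
qed

text \<open>Gram-Schmidt for the inner product \<open>q\<close> given by \<open>H\<close>. If the
  rows of \<open>V\<close> are \<open>q\<close>-orthonormal, then
  \<open>V ** H ** transpose V\<close> is the identity, so \<open>A = H ** transpose V\<close> is
  the inverse of \<open>V\<close>, and \<open>A ** transpose A = (A ** V) ** H = H\<close>.\<close>

lemma posdef_factorization:
  fixes H :: "real^'n^'n"
  assumes sym: "transpose H = H" and pos: "\<And>a. a \<noteq> 0 \<Longrightarrow> 0 < a \<bullet> (H *v a)"
  obtains A where "det A \<noteq> 0" "H = A ** transpose A"
proof -
  define q where "q a b = a \<bullet> (H *v b)" for a b
  have q_sym: "q a b = q b a" for a b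
    unfolding q_def by (metis dot_lmul_matrix inner_commute sym transpose_matrix_vector)
  have q_lin: "linear (q a)" for a
    unfolding q_def by (rule linearI) (simp_all add: matrix_vector_right_distrib inner_add_right matrix_vector_mult_scaleR)
  have "k \<le> CARD('n) \<Longrightarrow> \<exists>B. finite B \<and> card B = k \<and> (\<forall>a\<in>B. \<forall>b\<in>B. q a b = of_bool (a = b))" for k
  proof (induction k)
    case 0
    show ?case by (rule exI [of _ "{}"]) simp
  next
    case (Suc k)
    then obtain B where B: "finite B" "card B = k" and orth: "\<And>a b. a \<in> B \<Longrightarrow> b \<in> B \<Longrightarrow> q a b = of_bool (a = b)"
      by auto
    \<comment> \<open>The dimension of the span is at most the number of vectors, so a
      \<open>q\<close>-orthonormal set that is still too small misses some \<open>x\<close>;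
      removing the \<open>q\<close>-projection of \<open>x\<close> leaves a nonzero vector to
      normalize.\<close>
    have "dim B < CARD('n)"
      using dim_le_card' [OF B(1)] B(2) Suc.prems by simp
    then have "span B \<noteq> UNIV"
      using dim_span [of B] by (auto simp del: dim_span)
    then obtain x where x: "x \<notin> span B" by blast
    define y where "y = x - (\<Sum>b\<in>B. q b x *\<^sub>R b)"
    have "(\<Sum>b\<in>B. q b x *\<^sub>R b) \<in> span B"
      by (intro span_sum span_scale span_base)
    with x have "y \<noteq> 0" by (auto simp: y_def)
    then have y: "q y y > 0" using pos by (simp add: q_def)
    have qy: "q b y = 0" if "b \<in> B" for b
    proof -
      have "q b y = q b x - (\<Sum>c\<in>B. q c x * q b c)"
        by (simp add: y_def linear_diff [OF q_lin] linear_sum [OF q_lin] linear_scale [OF q_lin])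
      also have "(\<Sum>c\<in>B. q c x * q b c) = (\<Sum>c\<in>B. if c = b then q b x else 0)"
        by (rule sum.cong) (auto simp: orth that)
      finally show ?thesis using that B by simp
    qed
    define z where "z = (1 / sqrt (q y y)) *\<^sub>R y"
    have qz: "q a z = q a y / sqrt (q y y)" for a
      by (simp add: z_def linear_scale [OF q_lin])
    have zz: "q z z = 1"
      using y by (simp add: qz q_sym [of z y])
    have bz: "q b z = 0" if "b \<in> B" for b using qy that by (simp add: qz)
    have zb: "q z b = 0" if "b \<in> B" for b using bz [OF that] by (simp add: q_sym [of z b])
    have zB: "z \<notin> B" using bz zz by fastforce
    have "finite (insert z B)" "card (insert z B) = Suc k"
      "\<forall>a\<in>insert z B. \<forall>b\<in>insert z B. q a b = of_bool (a = b)"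
      using B orth zz bz zb zB by auto
    then show ?case by blast
  qed
  from this [OF le_refl] obtain B where "finite B" "card B = CARD('n)" and orth: "\<And>a b. a \<in> B \<Longrightarrow> b \<in> B \<Longrightarrow> q a b = of_bool (a = b)"
    by auto
  then obtain f where f: "bij_betw f (UNIV :: 'n set) B"
    by (metis finite_same_card_bij finite_class.finite_UNIV)
  define V :: "real^'n^'n" where "V = (\<chi> i. f i)"
  define A where "A = H ** transpose V"
  have "V ** A = mat 1"
  proof -
    have "(V ** A) $ i $ j = q (f i) (f j)" for i j
      by (simp add: V_def A_def q_def matrix_matrix_mult_def matrix_vector_mult_def transpose_def inner_vec_def)
    moreover have "q (f i) (f j) = of_bool (i = j)" for i j
      using f orth [of "f i" "f j"] by (auto simp: bij_betw_def inj_eq)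
    ultimately show ?thesis
      by (simp add: vec_eq_iff mat_def)
  qed
  then have AV: "A ** V = mat 1" using matrix_left_right_inverse by blast
  have "A ** transpose A = (A ** V) ** H"
    by (simp add: A_def matrix_transpose_mul sym matrix_mul_assoc)
  with AV have "H = A ** transpose A" by simp
  moreover have "det A \<noteq> 0"
    using arg_cong [OF AV, of det] by (auto simp: det_mul)
  ultimately show thesis using that by blast
qed

section \<open>Expectations over independent samples\<close>

text \<open>A finite sum over samples, shaped like \<open>prob_winner\<close> so that the two can be
  compared summand by summand. The values lie in an arbitrary real vector space because both real
  cutoffs and complex characters are averaged.\<close>

definition iid_expectation :: "'a set \<Rightarrow> ('a \<Rightarrow> real) \<Rightarrow> nat \<Rightarrow> ((nat \<Rightarrow> 'a) \<Rightarrow> 'b) \<Rightarrow> 'b::real_vector" where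
  "iid_expectation R p n f = (\<Sum>v\<in>PiE {..<n} (\<lambda>_. R). (\<Prod>i<n. p (v i)) *\<^sub>R f v)"

lemma iid_expectation_prod:
  fixes g :: "'a \<Rightarrow> 'b::real_normed_field"
  assumes "finite R"
  shows "iid_expectation R p n (\<lambda>v. \<Prod>i<n. g (v i)) = (\<Sum>r\<in>R. p r *\<^sub>R g r) ^ n"
proof -
  have "(\<Sum>r\<in>R. p r *\<^sub>R g r) ^ n = (\<Prod>i<n. \<Sum>r\<in>R. p r *\<^sub>R g r)"
    by simp
  also have "\<dots> = (\<Sum>v\<in>PiE {..<n} (\<lambda>_. R). \<Prod>i<n. p (v i) *\<^sub>R g (v i))"
    using assms by (intro prod_sum_PiE) auto
  also have "\<dots> = iid_expectation R p n (\<lambda>v. \<Prod>i<n. g (v i))"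
    by (simp add: iid_expectation_def scaleR_conv_of_real prod.distrib)
  finally show ?thesis by simp
qed

lemma iid_expectation_add:
  "iid_expectation R p n (\<lambda>v. f v + g v) = iid_expectation R p n f + iid_expectation R p n g"
  by (simp add: iid_expectation_def scaleR_add_right sum.distrib)

lemma iid_expectation_sum:
  "iid_expectation R p n (\<lambda>v. \<Sum>i\<in>I. f i v) = (\<Sum>i\<in>I. iid_expectation R p n (f i))"
  unfolding iid_expectation_def by (simp add: scaleR_sum_right) (rule sum.swap)

lemma iid_expectation_mult:
  "iid_expectation R p n (\<lambda>v. c * f v) = c * iid_expectation R p n f" for c :: "'b::real_algebra"
  by (simp add: iid_expectation_def sum_distrib_left)

lemma iid_expectation_Re:
  "iid_expectation R p n (\<lambda>v. Re (f v)) = Re (iid_expectation R p n f)"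
  by (simp add: iid_expectation_def)

lemma iid_expectation_const:
  assumes "finite R" "(\<Sum>r\<in>R. p r) = 1"
  shows "iid_expectation R p n (\<lambda>_. c :: real) = c"
  using iid_expectation_prod [OF assms(1), of p n "\<lambda>_. 1 :: real"] iid_expectation_mult [of R p n c "\<lambda>_. 1"] assms(2)
  by simp

lemma iid_expectation_mono:
  fixes f g :: "(nat \<Rightarrow> 'a) \<Rightarrow> real"
  assumes "\<And>r. r \<in> R \<Longrightarrow> 0 \<le> p r" "\<And>v. f v \<le> g v"
  shows "iid_expectation R p n f \<le> iid_expectation R p n g"
  unfolding iid_expectation_def real_scaleR_def
  using assms by (intro sum_mono mult_left_mono prod_nonneg) auto

text \<open>Compare the one-step average \<open>z n\<close> with \<open>w n\<close>, chosen so that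
  \<open>w n ^ n\<close> equals the limit for positive \<open>n\<close>. Both have norm at most 1,
  so telescoping gives \<open>norm (z n ^ n - w n ^ n) \<le> n * norm (z n - w n)\<close>, and it
  remains to show that \<open>n * (z n - w n)\<close> tends to 0. No complex logarithm
  occurs.\<close>

lemma tendsto_power_sum_cis:
  fixes p y :: "'a \<Rightarrow> real"
  assumes R: "finite R" and p_nonneg: "\<And>r. r \<in> R \<Longrightarrow> 0 \<le> p r" and p_sum: "(\<Sum>r\<in>R. p r) = 1"
    and mean: "(\<Sum>r\<in>R. p r * y r) = 0"
  shows "(\<lambda>n. (\<Sum>r\<in>R. p r *\<^sub>R cis (y r / sqrt n)) ^ n) \<longlonglongrightarrow> of_real (exp (- (\<Sum>r\<in>R. p r * (y r)\<^sup>2) / 2))"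
proof -
  define s where "s = (\<Sum>r\<in>R. p r * (y r)\<^sup>2)"
  define z where "z = (\<lambda>n. \<Sum>r\<in>R. p r *\<^sub>R cis (y r / sqrt (real n)))"
  define w where "w = (\<lambda>n. complex_of_real (exp (- s / (2 * real n))))"
  have s: "s \<ge> 0" unfolding s_def using p_nonneg by (intro sum_nonneg) auto
  have z1: "norm (z n) \<le> 1" for n
  proof -
    have "norm (z n) \<le> (\<Sum>r\<in>R. norm (p r *\<^sub>R cis (y r / sqrt (real n))))"
      unfolding z_def by (rule norm_sum)
    also have "\<dots> = 1" using p_nonneg p_sum by simp
    finally show ?thesis .
  qed
  have w1: "norm (w n) \<le> 1" for n using s by (simp add: w_def)
  \<comment> \<open>The linear term is removed beforehand: multiplied by \<open>n\<close> it would
    grow like \<open>sqrt n\<close>. It cancels in the weighted sum over \<open>R\<close> by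
    \<open>mean\<close>.\<close>
  have c: "(\<lambda>n. of_nat n * (cis (t / sqrt (real n)) - 1 - \<i> * of_real (t / sqrt (real n)))) \<longlonglongrightarrow> of_real (- t\<^sup>2 / 2)" for t
  proof -
    have "(\<lambda>n. real n * (cos (t / sqrt (real n)) - 1)) \<longlonglongrightarrow> - t\<^sup>2 / 2"
    proof (cases "t = 0")
      case False
      then have "t > 0 \<or> t < 0" by auto
      then show ?thesis by (elim disjE) (real_asymp simp: power2_eq_square)+
    qed simp
    moreover have "(\<lambda>n. real n * (sin (t / sqrt (real n)) - t / sqrt (real n))) \<longlonglongrightarrow> 0"
    proof (cases "t = 0")
      case False
      then have "t > 0 \<or> t < 0" by auto
      then show ?thesis by (elim disjE) (real_asymp simp: power2_eq_square)+
    qed simp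
    ultimately show ?thesis by (simp add: tendsto_complex_iff)
  qed
  have e: "(\<lambda>n. real n * (1 - exp (- s / (2 * real n)))) \<longlonglongrightarrow> s / 2"
    by real_asymp
  have "(\<lambda>n. (\<Sum>r\<in>R. of_real (p r) * (of_nat n * (cis (y r / sqrt (real n)) - 1 - \<i> * of_real (y r / sqrt (real n)))))
      + of_real (real n * (1 - exp (- s / (2 * real n))))) \<longlonglongrightarrow> (\<Sum>r\<in>R. of_real (p r) * of_real (- (y r)\<^sup>2 / 2)) + of_real (s / 2)"
    by (intro tendsto_intros c tendsto_of_real e)
  moreover have "(\<Sum>r\<in>R. of_real (p r) * of_real (- (y r)\<^sup>2 / 2)) + complex_of_real (s / 2) = 0"
    by (simp add: s_def sum_divide_distrib sum_negf)
  moreover have "(\<Sum>r\<in>R. of_real (p r) * (of_nat n * (cis (y r / sqrt (real n)) - 1 - \<i> * of_real (y r / sqrt (real n)))))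
      + of_real (real n * (1 - exp (- s / (2 * real n)))) = of_nat n * (z n - w n)" for n
  proof -
    have "(\<Sum>r\<in>R. of_real (p r) * (of_nat n * (cis (y r / sqrt (real n)) - 1 - \<i> * of_real (y r / sqrt (real n)))))
      = of_nat n * (z n - of_real (\<Sum>r\<in>R. p r) - \<i> * of_real ((\<Sum>r\<in>R. p r * y r) / sqrt (real n)))"
      by (simp add: z_def sum_subtractf sum.distrib sum_distrib_left sum_divide_distrib algebra_simps scaleR_conv_of_real)
    then show ?thesis by (simp add: p_sum mean w_def algebra_simps)
  qed
  ultimately have "(\<lambda>n. of_nat n * (z n - w n)) \<longlonglongrightarrow> 0" by simp
  from tendsto_norm_zero [OF this] have "(\<lambda>n. real n * norm (z n - w n)) \<longlonglongrightarrow> 0"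
    by (simp add: norm_mult)
  then have "(\<lambda>n. z n ^ n - w n ^ n) \<longlonglongrightarrow> 0"
    by (rule Lim_null_comparison [rotated]) (use norm_power_diff [OF z1 w1] in auto)
  moreover have "w n ^ n = of_real (exp (- s / 2))" if "n > 0" for n
  proof -
    have "exp (- s / (2 * real n)) ^ n = exp (- s / 2)"
      using that by (simp add: exp_of_nat_mult [symmetric])
    then show ?thesis unfolding w_def of_real_power [symmetric] by simp
  qed
  then have "(\<lambda>n. w n ^ n) \<longlonglongrightarrow> of_real (exp (- s / 2))"
    by (intro tendsto_eventually eventually_sequentiallyI [of 1]) auto
  ultimately have "(\<lambda>n. (z n ^ n - w n ^ n) + w n ^ n) \<longlonglongrightarrow> 0 + of_real (exp (- s / 2))"
    by (rule tendsto_add)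
  then show ?thesis by (simp add: z_def s_def)
qed

section \<open>Exponential moments, uniformly in the number of samples\<close>

lemma exp_le_quadratic:
  fixes x :: real
  assumes "\<bar>x\<bar> \<le> 1"
  shows "exp x \<le> 1 + x + x\<^sup>2"
proof (cases "x \<ge> 0")
  case True
  then show ?thesis using exp_bound assms by auto
next
  case False
  define t where "t = - x"
  have t: "t \<ge> 0" using False by (simp add: t_def)
  \<comment> \<open>The second factor is a lower bound for \<open>exp t\<close>, so a product of at
    least 1 makes the first factor an upper bound for \<open>exp (- t)\<close>.\<close>
  have "1 \<le> (1 - t + t\<^sup>2) * (1 + t + t\<^sup>2 / 2)"
  proof -
    have "(1 - t + t\<^sup>2) * (1 + t + t\<^sup>2 / 2) = 1 + (t^2 / 2 + t^3 / 2 + t^4 / 2)"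
      by (simp add: field_simps power2_eq_square power3_eq_cube power4_eq_xxxx)
    then show ?thesis using t by simp
  qed
  also have "\<dots> \<le> (1 - t + t\<^sup>2) * exp t"
  proof (rule mult_left_mono)
    show "1 + t + t\<^sup>2 / 2 \<le> exp t" by (rule exp_lower_Taylor_quadratic) (rule t)
    have "0 \<le> (1 - t)\<^sup>2 + t" using t by simp
    then show "0 \<le> 1 - t + t\<^sup>2" by (simp add: power2_eq_square algebra_simps)
  qed
  finally show ?thesis by (simp add: t_def exp_minus field_simps)
qed

text \<open>One sample contributes a factor of at most \<open>1 + 1 / n\<close>, since the linear
  term averages to zero and \<open>bound\<close> controls the square. This is at most
  \<open>exp (1 / n)\<close>, whose \<open>n\<close>-th power is the constant
  \<open>exp 1\<close>.\<close>

lemma iid_expectation_exp_le: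
  fixes p y :: "'a \<Rightarrow> real"
  assumes R: "finite R" and p_nonneg: "\<And>r. r \<in> R \<Longrightarrow> 0 \<le> p r" and p_sum: "(\<Sum>r\<in>R. p r) = 1"
    and mean: "(\<Sum>r\<in>R. p r * y r) = 0" and bound: "\<And>r. r \<in> R \<Longrightarrow> \<bar>y r\<bar> \<le> 1"
  shows "iid_expectation R p n (\<lambda>v. exp ((\<Sum>i<n. y (v i)) / sqrt n)) \<le> exp 1"
proof (cases "n = 0")
  case True
  then show ?thesis by (simp add: iid_expectation_def)
next
  case False
  have sq: "(y r / sqrt n)\<^sup>2 \<le> 1 / n" if "r \<in> R" for r
    using bound [OF that] False by (simp add: power_divide abs_square_le_1 divide_right_mono)
  have le1: "\<bar>y r / sqrt n\<bar> \<le> 1" if "r \<in> R" for r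
    using order_trans [OF sq [OF that], of 1] False by (simp add: abs_square_le_1)
  have "(\<Sum>r\<in>R. p r *\<^sub>R exp (y r / sqrt n)) \<le> (\<Sum>r\<in>R. p r * (1 + y r / sqrt n + 1 / n))"
    using p_nonneg sq exp_le_quadratic [OF le1]
    by (intro sum_mono) (auto intro!: mult_left_mono, smt (verit, ccfv_SIG))
  also have "\<dots> = (\<Sum>r\<in>R. p r) * (1 + 1 / n) + (\<Sum>r\<in>R. p r * y r) / sqrt n"
    by (simp add: sum_distrib_left sum_distrib_right sum_divide_distrib sum.distrib algebra_simps)
  also have "\<dots> \<le> exp (1 / n)"
    using exp_ge_add_one_self [of "1 / n"] by (simp add: p_sum mean)
  finally have le: "(\<Sum>r\<in>R. p r *\<^sub>R exp (y r / sqrt n)) \<le> exp (1 / n)" .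
  have "iid_expectation R p n (\<lambda>v. exp ((\<Sum>i<n. y (v i)) / sqrt n)) = (\<Sum>r\<in>R. p r *\<^sub>R exp (y r / sqrt n)) ^ n"
    using iid_expectation_prod [OF R, of p n "\<lambda>r. exp (y r / sqrt n)"] by (simp add: exp_sum sum_divide_distrib)
  also have "\<dots> \<le> exp (1 / n) ^ n"
    using p_nonneg by (intro power_mono le sum_nonneg) auto
  also have "\<dots> = exp 1"
    using False by (simp add: exp_of_nat_mult [symmetric])
  finally show ?thesis .
qed

section \<open>The central limit theorem on an orthant\<close>

text \<open>The phase \<open>b\<close> makes constants and sines instances of the single generator,
  so closure under products is one product-to-sum identity, and limits of expectations need checking
  only for a cosine.\<close>

inductive trig_poly :: "('a::real_inner \<Rightarrow> real) \<Rightarrow> bool" where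
  cos: "trig_poly (\<lambda>x. c * cos (a \<bullet> x + b))"
| add: "trig_poly f \<Longrightarrow> trig_poly g \<Longrightarrow> trig_poly (\<lambda>x. f x + g x)"

lemma trig_poly_const: "trig_poly (\<lambda>_. c)"
  using trig_poly.cos [of c 0 0] by simp

lemma trig_poly_sin: "trig_poly (\<lambda>x. c * sin (a \<bullet> x))"
  using trig_poly.cos [of c a "- pi / 2"] by (simp add: cos_diff)

lemma trig_poly_sum:
  assumes "finite I" "\<And>i. i \<in> I \<Longrightarrow> trig_poly (f i)"
  shows "trig_poly (\<lambda>x. \<Sum>i\<in>I. f i x)"
  using assms by (induction I) (auto intro: trig_poly_const trig_poly.add)

lemma trig_poly_mult:
  assumes "trig_poly f" "trig_poly g"
  shows "trig_poly (\<lambda>x. f x * g x)"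
  using assms(1)
proof induction
  case (cos c a b)
  show ?case
    using assms(2)
  proof induction
    case (cos c' a' b')
    have "(\<lambda>x. c * cos (a \<bullet> x + b) * (c' * cos (a' \<bullet> x + b'))) =
      (\<lambda>x. c * c' / 2 * cos ((a - a') \<bullet> x + (b - b')) + c * c' / 2 * cos ((a + a') \<bullet> x + (b + b')))"
    proof
      fix x
      have "c * cos (a \<bullet> x + b) * (c' * cos (a' \<bullet> x + b')) = c * c' * (cos (a \<bullet> x + b) * cos (a' \<bullet> x + b'))"
        by simp
      also have "\<dots> = c * c' / 2 * cos ((a \<bullet> x + b) - (a' \<bullet> x + b')) + c * c' / 2 * cos ((a \<bullet> x + b) + (a' \<bullet> x + b'))"
        unfolding cos_times_cos by (simp add: algebra_simps add_divide_distrib)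
      finally show "c * cos (a \<bullet> x + b) * (c' * cos (a' \<bullet> x + b')) =
        c * c' / 2 * cos ((a - a') \<bullet> x + (b - b')) + c * c' / 2 * cos ((a + a') \<bullet> x + (b + b'))"
        by (simp add: inner_diff_left inner_add_left algebra_simps)
    qed
    then show ?case by (simp only:) (intro trig_poly.intros)
  next
    case (add f g)
    then show ?case by (simp only: distrib_left) (rule trig_poly.add)
  qed
next
  case (add f g)
  then show ?case by (simp only: distrib_right) (rule trig_poly.add)
qed

text \<open>The link to Stone-Weierstrass: polynomials are dense among continuous functions on the
  cube, and precomposition with coordinatewise sines turns them into trigonometric polynomials on
  the whole space.\<close>

lemma trig_poly_polynomial_sin:
  fixes g :: "real^'n \<Rightarrow> real"
  assumes "real_polynomial_function g"
  shows "trig_poly (\<lambda>x::real^'n. g (\<chi> j. sin (s * x $ j)))"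
  using assms
proof induction
  case (linear f)
  then interpret bounded_linear f .
  have *: "f y = (\<Sum>j\<in>UNIV. y $ j * f (axis j 1))" for y
  proof -
    have "f y = f (\<Sum>j\<in>UNIV. (y $ j) *\<^sub>R axis j 1)"
      using basis_expansion [of y] by (simp add: scalar_mult_eq_scaleR)
    then show ?thesis by (simp add: sum scaleR)
  qed
  have "(\<lambda>x::real^'n. f (\<chi> j. sin (s * x $ j))) = (\<lambda>x. \<Sum>j\<in>UNIV. f (axis j 1) * sin ((s *\<^sub>R axis j 1) \<bullet> x))"
    by (rule ext, subst *) (simp add: inner_axis' mult.commute)
  then show ?case by (simp only:) (intro trig_poly_sum trig_poly_sin finite)
qed (intro trig_poly_const trig_poly.add trig_poly_mult; assumption)+

text \<open>The covariance comes already factored, so that the limit law is that of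
  \<open>A *v v\<close>. It is stated as a quadratic form because only the variances of the
  projections \<open>a \<bullet> y r\<close> are ever compared.\<close>

locale finite_iid_vector =
  fixes R :: "'a set" and p :: "'a \<Rightarrow> real" and y :: "'a \<Rightarrow> real^'n" and A :: "real^'n^'n"
  assumes finite: "finite R"
    and p_nonneg: "\<And>r. r \<in> R \<Longrightarrow> 0 \<le> p r"
    and p_sum: "(\<Sum>r\<in>R. p r) = 1"
    and mean: "(\<Sum>r\<in>R. p r *\<^sub>R y r) = 0"
    and bound: "\<And>r j. r \<in> R \<Longrightarrow> \<bar>y r $ j\<bar> \<le> 1"
    and cov: "\<And>a. (\<Sum>r\<in>R. p r * (a \<bullet> y r)\<^sup>2) = a \<bullet> ((A ** transpose A) *v a)"
    and nonsingular: "det A \<noteq> 0"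
begin

abbreviation expect :: "nat \<Rightarrow> ((nat \<Rightarrow> 'a) \<Rightarrow> 'b) \<Rightarrow> 'b::real_vector" where
  "expect \<equiv> iid_expectation R p"

definition clt_sum :: "nat \<Rightarrow> (nat \<Rightarrow> 'a) \<Rightarrow> real^'n" where
  "clt_sum n v = (1 / sqrt n) *\<^sub>R (\<Sum>i<n. y (v i))"

sublocale std: prob_space "std_gaussian :: (real^'n) measure"
  by (rule prob_space_std_gaussian)

lemma measurable_mult [measurable]: "(*v) A \<in> borel_measurable borel"
  by (intro borel_measurable_continuous_onI linear_continuous_on) simp

text \<open>The Cramer-Wold reduction: in direction \<open>a\<close> the summands are the scalars
  \<open>a \<bullet> y r\<close>, whose variance equals the squared length of
  \<open>transpose A *v a\<close> by \<open>cov\<close>. That squared length is what the Gaussian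
  characteristic function sees; the phase \<open>b\<close> is the constant factor
  \<open>cis b\<close>.\<close>

lemma expect_cos_tendsto:
  "(\<lambda>n. expect n (\<lambda>v. cos (a \<bullet> clt_sum n v + b))) \<longlonglongrightarrow> (\<integral>v. cos (a \<bullet> (A *v v) + b) \<partial>std_gaussian)"
proof -
  have [measurable]: "cis \<in> borel_measurable borel"
    by (intro borel_measurable_continuous_onI continuous_intros)
  have "(\<Sum>r\<in>R. p r * (a \<bullet> y r)) = a \<bullet> (\<Sum>r\<in>R. p r *\<^sub>R y r)"
    by (simp add: inner_sum_right)
  then have "(\<lambda>n. Re (cis b * (\<Sum>r\<in>R. p r *\<^sub>R cis (a \<bullet> y r / sqrt n)) ^ n)) \<longlonglongrightarrow>
      Re (cis b * of_real (exp (- (\<Sum>r\<in>R. p r * (a \<bullet> y r)\<^sup>2) / 2)))"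
    by (intro tendsto_intros tendsto_power_sum_cis finite p_nonneg p_sum) (simp_all add: mean)
  moreover have "expect n (\<lambda>v. cos (a \<bullet> clt_sum n v + b)) = Re (cis b * (\<Sum>r\<in>R. p r *\<^sub>R cis (a \<bullet> y r / sqrt n)) ^ n)" for n
  proof -
    have cis_sum: "cis (\<Sum>i\<in>B. g i) = (\<Prod>i\<in>B. cis (g i))" if "Finite_Set.finite B" for B and g :: "nat \<Rightarrow> real"
      using that by induction (auto simp: cis_mult [symmetric])
    have "cos (a \<bullet> clt_sum n v + b) = Re (cis b * (\<Prod>i<n. cis (a \<bullet> y (v i) / sqrt n)))" for v
    proof -
      have "a \<bullet> clt_sum n v = (\<Sum>i<n. a \<bullet> y (v i) / sqrt n)"
        by (simp add: clt_sum_def inner_sum_right sum_divide_distrib)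
      then show ?thesis by (simp add: cis_sum [symmetric] cis_mult add.commute)
    qed
    then show ?thesis
      using iid_expectation_prod [OF finite, of p n "\<lambda>r. cis (a \<bullet> y r / sqrt n)"]
      by (simp add: iid_expectation_Re iid_expectation_mult del: times_complex.sel)
  qed
  moreover have "(\<integral>v. cos (a \<bullet> (A *v v) + b) \<partial>std_gaussian) =
      Re (cis b * of_real (exp (- (\<Sum>r\<in>R. p r * (a \<bullet> y r)\<^sup>2) / 2)))"
  proof -
    let ?c = "transpose A *v a"
    have inner: "a \<bullet> (A *v v) = ?c \<bullet> v" for v
      by (simp add: dot_lmul_matrix transpose_matrix_vector)
    have "?c \<bullet> ?c = (\<Sum>r\<in>R. p r * (a \<bullet> y r)\<^sup>2)"
      by (simp only: cov matrix_vector_mul_assoc [symmetric] inner)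
    then have "cis b * of_real (exp (- (\<Sum>r\<in>R. p r * (a \<bullet> y r)\<^sup>2) / 2)) = cis b * (\<integral>v. cis (?c \<bullet> v) \<partial>std_gaussian)"
      by (simp add: char_std_gaussian)
    also have "\<dots> = (\<integral>v. cis b * cis (?c \<bullet> v) \<partial>std_gaussian)"
      by simp
    also have "Re \<dots> = (\<integral>v. Re (cis b * cis (?c \<bullet> v)) \<partial>std_gaussian)"
    proof (rule integral_Re [symmetric])
      show "integrable std_gaussian (\<lambda>v. cis b * cis (?c \<bullet> v))"
        by (rule std.integrable_const_bound [of _ 1]) (auto simp: norm_mult)
    qed
    finally show ?thesis by (simp add: inner cis_mult add.commute)
  qed
  ultimately show ?thesis by simp
qed

lemma expect_trig_poly_tendsto:
  assumes "trig_poly f"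
  shows "integrable std_gaussian (\<lambda>v. f (A *v v)) \<and>
    (\<lambda>n. expect n (\<lambda>v. f (clt_sum n v))) \<longlonglongrightarrow> (\<integral>v. f (A *v v) \<partial>std_gaussian)"
  using assms
proof induction
  case (cos c a b)
  have "integrable std_gaussian (\<lambda>v. cos (a \<bullet> (A *v v) + b))"
    by (rule std.integrable_const_bound [of _ 1]) auto
  then show ?case
    using tendsto_mult_left [OF expect_cos_tendsto [of a b], of c] by (simp add: iid_expectation_mult)
next
  case (add f g)
  then show ?case by (auto simp: iid_expectation_add intro!: tendsto_intros)
qed

text \<open>The sine vector lies in a compact cube for every \<open>x\<close>, so a uniform
  polynomial approximation of \<open>F\<close> there is a uniform approximation of \<open>f\<close>
  on the whole space. Expectations on both sides then move by at most \<open>e / 3\<close>, and no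
  tightness is required.\<close>

lemma expect_continuous_sin_tendsto:
  fixes F :: "real^'n \<Rightarrow> real" and s :: real
  assumes F: "continuous_on (cbox (-1) 1) F"
  defines "f \<equiv> \<lambda>x. F (\<chi> j. sin (s * x $ j))"
  shows "integrable std_gaussian (\<lambda>v. f (A *v v)) \<and>
    (\<lambda>n. expect n (\<lambda>v. f (clt_sum n v))) \<longlonglongrightarrow> (\<integral>v. f (A *v v) \<partial>std_gaussian)"
proof -
  have sin: "(\<chi> j. sin (s * x $ j)) \<in> cbox (-1) 1" for x :: "real^'n"
    by (auto simp: mem_box_cart)
  have "continuous_on UNIV f"
    unfolding f_def by (rule continuous_on_compose2 [OF F]) (auto intro!: continuous_intros simp: sin)
  then have [measurable]: "f \<in> borel_measurable borel"
    by (rule borel_measurable_continuous_onI)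
  have "bounded (F ` cbox (-1) 1)"
    by (intro compact_imp_bounded compact_continuous_image F compact_cbox)
  then obtain B where "\<And>x. x \<in> cbox (-1) 1 \<Longrightarrow> norm (F x) \<le> B"
    by (auto simp: bounded_iff)
  then have B: "norm (f x) \<le> B" for x using sin by (auto simp: f_def)
  have int: "integrable std_gaussian (\<lambda>v. f (A *v v))"
    by (rule std.integrable_const_bound [of _ B]) (use B in auto)
  moreover have "(\<lambda>n. expect n (\<lambda>v. f (clt_sum n v))) \<longlonglongrightarrow> (\<integral>v. f (A *v v) \<partial>std_gaussian)"
  proof (rule LIMSEQ_I)
    fix e :: real assume "0 < e"
    then have e: "0 < e / 3" by simp
    obtain g where g: "real_polynomial_function g" and Fg: "\<And>x. x \<in> cbox (-1) 1 \<Longrightarrow> \<bar>F x - g x\<bar> < e / 3"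
      using Stone_Weierstrass_real_polynomial_function [OF compact_cbox F e] by blast
    define h where "h x = g (\<chi> j. sin (s * x $ j))" for x :: "real^'n"
    have "trig_poly h" unfolding h_def by (rule trig_poly_polynomial_sin [OF g])
    from expect_trig_poly_tendsto [OF this]
    have h: "integrable std_gaussian (\<lambda>v. h (A *v v))"
      "(\<lambda>n. expect n (\<lambda>v. h (clt_sum n v))) \<longlonglongrightarrow> (\<integral>v. h (A *v v) \<partial>std_gaussian)"
      by auto
    have fh: "f x \<le> h x + e / 3" "h x \<le> f x + e / 3" for x
    proof -
      have "\<bar>f x - h x\<bar> < e / 3" using Fg [OF sin [of x]] by (simp only: f_def h_def)
      then show "f x \<le> h x + e / 3" "h x \<le> f x + e / 3" by linarith+
    qed
    have prob1: "std.prob UNIV = 1" using std.prob_space by simp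
    have "(\<integral>v. f (A *v v) \<partial>std_gaussian) \<le> (\<integral>v. h (A *v v) + e / 3 \<partial>std_gaussian)"
      by (intro integral_mono int Bochner_Integration.integrable_add h fh) auto
    then have 1: "(\<integral>v. f (A *v v) \<partial>std_gaussian) \<le> (\<integral>v. h (A *v v) \<partial>std_gaussian) + e / 3"
      using h prob1 by simp
    have "(\<integral>v. h (A *v v) \<partial>std_gaussian) \<le> (\<integral>v. f (A *v v) + e / 3 \<partial>std_gaussian)"
      by (intro integral_mono int Bochner_Integration.integrable_add h fh) auto
    then have 2: "(\<integral>v. h (A *v v) \<partial>std_gaussian) \<le> (\<integral>v. f (A *v v) \<partial>std_gaussian) + e / 3"
      using int prob1 by simp
    have 3: "expect n (\<lambda>v. f (clt_sum n v)) \<le> expect n (\<lambda>v. h (clt_sum n v)) + e / 3" for n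
    proof -
      have "expect n (\<lambda>v. f (clt_sum n v)) \<le> expect n (\<lambda>v. h (clt_sum n v) + e / 3)"
        by (intro iid_expectation_mono p_nonneg fh)
      then show ?thesis by (simp only: iid_expectation_add iid_expectation_const [OF finite p_sum])
    qed
    have 4: "expect n (\<lambda>v. h (clt_sum n v)) \<le> expect n (\<lambda>v. f (clt_sum n v)) + e / 3" for n
    proof -
      have "expect n (\<lambda>v. h (clt_sum n v)) \<le> expect n (\<lambda>v. f (clt_sum n v) + e / 3)"
        by (intro iid_expectation_mono p_nonneg fh)
      then show ?thesis by (simp only: iid_expectation_add iid_expectation_const [OF finite p_sum])
    qed
    from LIMSEQ_D [OF h(2) e] obtain N where
      N: "\<And>n. n \<ge> N \<Longrightarrow> norm (expect n (\<lambda>v. h (clt_sum n v)) - (\<integral>v. h (A *v v) \<partial>std_gaussian)) < e / 3"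
      by blast
    have "norm (expect n (\<lambda>v. f (clt_sum n v)) - (\<integral>v. f (A *v v) \<partial>std_gaussian)) < e" if "n \<ge> N" for n
      using N [OF that] 1 2 3 [of n] 4 [of n] unfolding real_norm_def by linarith
    then show "\<exists>N. \<forall>n\<ge>N. norm (expect n (\<lambda>v. f (clt_sum n v)) - (\<integral>v. f (A *v v) \<partial>std_gaussian)) < e"
      by blast
  qed
  ultimately show ?thesis by blast
qed

end

section \<open>Periodic cutoffs around the indicator of the orthant\<close>

definition clamp01 :: "real \<Rightarrow> real" where "clamp01 t = max 0 (min 1 t)"

lemma clamp01_bounds [simp]: "0 \<le> clamp01 t" "clamp01 t \<le> 1"
  by (auto simp: clamp01_def)

lemma continuous_on_clamp01 [continuous_intros]:
  "continuous_on S f \<Longrightarrow> continuous_on S (\<lambda>x. clamp01 (f x))"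
  unfolding clamp01_def by (intro continuous_intros)

lemma sin_scaled_sign:
  fixes t :: real
  assumes "k > 0"
  shows "0 < t \<Longrightarrow> t \<le> k \<Longrightarrow> 0 \<le> sin (t / k)" and "t \<le> 0 \<Longrightarrow> - k \<le> t \<Longrightarrow> sin (t / k) \<le> 0"
proof -
  assume "0 < t" "t \<le> k"
  then have "0 \<le> t / k" "t / k \<le> 1" using assms by auto
  then show "0 \<le> sin (t / k)" using pi_gt3 by (intro sin_ge_zero) auto
next
  assume "t \<le> 0" "- k \<le> t"
  then have "0 \<le> - t / k" "- t / k \<le> 1" using assms by (auto simp: field_simps)
  then have "0 \<le> sin (- t / k)" using pi_gt3 by (intro sin_ge_zero) auto
  then show "sin (t / k) \<le> 0" by simp
qed

text \<open>The frequency tends to \<open>0\<close> slowly enough compared with the slope for the periodic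
  cutoffs to approach a step function on the whole line.\<close>
lemma clamp01_sin_tendsto:
  fixes t c :: real
  assumes "t \<noteq> 0"
  shows "(\<lambda>k. clamp01 (c + (real k)\<^sup>2 * sin (inverse (real k) * t))) \<longlonglongrightarrow> of_bool (0 < t)"
proof -
  have "eventually (\<lambda>k. clamp01 (c + (real k)\<^sup>2 * sin (inverse (real k) * t)) = of_bool (0 < t)) sequentially"
  proof (cases "t > 0")
    case True
    then have "filterlim (\<lambda>k. c + (real k)\<^sup>2 * sin (inverse (real k) * t)) at_top sequentially"
      by real_asymp
    then have "eventually (\<lambda>k. c + (real k)\<^sup>2 * sin (inverse (real k) * t) \<ge> 1) sequentially"
      by (simp add: filterlim_at_top)
    then show ?thesis
      by eventually_elim (use True in \<open>simp add: clamp01_def\<close>)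
  next
    case False
    with assms have t: "t < 0" by simp
    then have "filterlim (\<lambda>k. c + (real k)\<^sup>2 * sin (inverse (real k) * t)) at_bot sequentially"
      by real_asymp
    then have "eventually (\<lambda>k. c + (real k)\<^sup>2 * sin (inverse (real k) * t) \<le> 0) sequentially"
      by (simp add: filterlim_at_bot)
    then show ?thesis
      by eventually_elim (use t in \<open>simp add: clamp01_def\<close>)
  qed
  then show ?thesis by (rule tendsto_eventually)
qed

context finite_iid_vector
begin

text \<open>Inside the window \<open>\<bar>x $ j\<bar> \<le> k\<close> the sine has the sign of
  \<open>x $ j\<close>. Hence \<open>c = 1\<close> makes each factor 1 at a positive coordinate, an
  upper approximation of the indicator, and \<open>c = 0\<close> makes it 0 at a nonpositive one, a
  lower approximation.\<close>

definition cutoff :: "real \<Rightarrow> nat \<Rightarrow> real^'n \<Rightarrow> real" where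
  "cutoff c k x = (\<Prod>j\<in>UNIV. clamp01 (c + (real k)\<^sup>2 * sin (inverse (real k) * x $ j)))"

text \<open>A correction that is at least 1 as soon as some coordinate leaves the window, where
  periodicity can give a cutoff the wrong value. Exponentials are used because their expectations
  are bounded uniformly in \<open>n\<close>.\<close>

definition tail :: "nat \<Rightarrow> real^'n \<Rightarrow> real" where
  "tail k x = (\<Sum>j\<in>UNIV. exp (- real k) * (exp (x $ j) + exp (- x $ j)))"

lemma cutoff_bounds: "0 \<le> cutoff c k x" "cutoff c k x \<le> 1"
  unfolding cutoff_def by (auto intro: prod_nonneg prod_le_1)

lemma tail_ge:
  fixes x :: "real^'n"
  shows "tail k x \<ge> 0" and "real k < \<bar>x $ j\<bar> \<Longrightarrow> tail k x \<ge> 1"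
proof -
  show "tail k x \<ge> 0" unfolding tail_def by (intro sum_nonneg) (simp add: add_nonneg_nonneg)
  assume "real k < \<bar>x $ j\<bar>"
  then have "1 \<le> exp (- real k) * exp \<bar>x $ j\<bar>" by (simp add: exp_add [symmetric])
  also have "\<dots> \<le> exp (- real k) * (exp (x $ j) + exp (- x $ j))"
    by (cases "x $ j \<ge> 0") auto
  also have "\<dots> \<le> tail k x"
    unfolding tail_def by (rule member_le_sum) (auto simp: add_nonneg_nonneg)
  finally show "tail k x \<ge> 1" .
qed

lemma orthant_le_cutoff:
  fixes x :: "real^'n"
  assumes "k > 0"
  shows "of_bool (\<forall>j. 0 < x $ j) \<le> cutoff 1 k x + tail k x"
proof (cases "(\<forall>j. 0 < x $ j) \<and> (\<forall>j. \<bar>x $ j\<bar> \<le> real k)")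
  case True
  have "clamp01 (1 + (real k)\<^sup>2 * sin (inverse (real k) * x $ j)) = 1" for j
    using sin_scaled_sign(1) [of "real k" "x $ j"] True assms
    by (auto simp: clamp01_def field_simps abs_le_iff)
  then have "cutoff 1 k x = 1" by (simp add: cutoff_def)
  then show ?thesis using tail_ge(1) [of k x] by simp
next
  case False
  then consider "\<not> (\<forall>j. 0 < x $ j)" | j where "real k < \<bar>x $ j\<bar>" by (auto simp: not_le)
  then have "of_bool (\<forall>j. 0 < x $ j) \<le> tail k x"
  proof cases
    case 1
    then show ?thesis using tail_ge(1) [of k x] by auto
  next
    case (2 j)
    then have "1 \<le> tail k x" by (rule tail_ge(2))
    then show ?thesis by (simp add: of_bool_def)
  qed
  then show ?thesis using cutoff_bounds(1) [of 1 k x] by simp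
qed

lemma cutoff_le_orthant:
  fixes x :: "real^'n"
  assumes "k > 0"
  shows "cutoff 0 k x \<le> of_bool (\<forall>j. 0 < x $ j) + tail k x"
proof -
  consider "\<forall>j. 0 < x $ j" | j where "real k < \<bar>x $ j\<bar>" | j where "x $ j \<le> 0" "\<bar>x $ j\<bar> \<le> real k"
    by (meson not_le)
  then show ?thesis
  proof cases
    case 1
    then show ?thesis using cutoff_bounds(2) [of 0 k x] tail_ge(1) [of k x] by simp
  next
    case (2 j)
    then have "1 \<le> tail k x" by (rule tail_ge(2))
    moreover have "0 \<le> (of_bool (\<forall>j. 0 < x $ j) :: real)" by simp
    ultimately show ?thesis using cutoff_bounds(2) [of 0 k x] by linarith
  next
    case (3 j)
    have "(real k)\<^sup>2 * sin (inverse (real k) * x $ j) \<le> 0"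
      using sin_scaled_sign(2) [of "real k" "x $ j"] 3 assms
      by (intro mult_nonneg_nonpos) (auto simp: field_simps abs_le_iff)
    then have "clamp01 (0 + (real k)\<^sup>2 * sin (inverse (real k) * x $ j)) = 0"
      by (simp add: clamp01_def)
    then have "cutoff 0 k x = 0" unfolding cutoff_def by (intro prod_zero) auto
    then show ?thesis using tail_ge(1) [of k x] by simp
  qed
qed

text \<open>Each coordinate contributes two exponential moments, one per sign, each at most
  \<open>exp 1\<close>. The bound is free of \<open>n\<close>.\<close>

lemma expect_tail_le: "expect n (\<lambda>v. tail k (clt_sum n v)) \<le> 2 * real CARD('n) * exp 1 * exp (- real k)"
proof -
  have comp: "(\<Sum>r\<in>R. p r * y r $ j) = 0" for j
    using arg_cong [OF mean, of "\<lambda>x. x $ j"] by simp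
  have *: "expect n (\<lambda>v. exp (clt_sum n v $ j)) \<le> exp 1" "expect n (\<lambda>v. exp (- clt_sum n v $ j)) \<le> exp 1" for j
    using iid_expectation_exp_le [OF finite p_nonneg p_sum, of "\<lambda>r. y r $ j" n]
      iid_expectation_exp_le [OF finite p_nonneg p_sum, of "\<lambda>r. - y r $ j" n]
    by (simp_all add: clt_sum_def comp bound sum_negf)
  have "expect n (\<lambda>v. tail k (clt_sum n v)) = (\<Sum>j\<in>UNIV. exp (- real k) *
      (expect n (\<lambda>v. exp (clt_sum n v $ j)) + expect n (\<lambda>v. exp (- clt_sum n v $ j))))"
    unfolding tail_def by (simp only: iid_expectation_sum iid_expectation_mult iid_expectation_add)
  also have "\<dots> \<le> (\<Sum>j\<in>(UNIV :: 'n set). exp (- real k) * (exp 1 + exp 1))"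
    by (intro sum_mono mult_left_mono add_mono *) simp
  finally show ?thesis by (simp add: mult_ac)
qed

lemma continuous_on_prod_clamp01:
  "continuous_on S (\<lambda>z::real^'n. \<Prod>j\<in>UNIV. clamp01 (c + (real k)\<^sup>2 * z $ j))"
  by (intro continuous_intros)

lemma expect_cutoff_tendsto:
  "(\<lambda>n. expect n (\<lambda>v. cutoff c k (clt_sum n v))) \<longlonglongrightarrow> (\<integral>v. cutoff c k (A *v v) \<partial>std_gaussian)"
  using expect_continuous_sin_tendsto [OF continuous_on_prod_clamp01 [of _ c k], of "inverse (real k)"]
  by (simp add: cutoff_def)

text \<open>A nonsingular matrix has no zero row, so each face lies in a hyperplane of measure zero.
  On the faces the limits of the upper and lower cutoffs may differ: at a zero coordinate the factor
  stays at \<open>clamp01 c\<close>.\<close>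

lemma AE_nonzero: "AE v in std_gaussian. (A *v v) $ j \<noteq> 0"
proof -
  have "row j A \<noteq> 0" using nonsingular det_zero_row by blast
  then have "negligible {v. row j A \<bullet> v = 0}" by (intro negligible_hyperplane) simp
  moreover have "closed {v. row j A \<bullet> v = 0}" by (rule closed_hyperplane)
  ultimately have "{v. row j A \<bullet> v = 0} \<in> null_sets lborel"
    by (simp add: negligible_iff_null_sets null_sets_completion_iff borel_closed)
  then have "AE v in lborel. row j A \<bullet> v \<noteq> 0"
    by (rule AE_I') auto
  moreover have "(A *v v) $ j = row j A \<bullet> v" for v
    by (simp add: matrix_vector_mul_component row_def)
  ultimately show ?thesis
    unfolding std_gaussian_def by (subst AE_density) (auto elim: eventually_mono)
qed

lemma integral_cutoff_tendsto:
  "(\<lambda>k. \<integral>v. cutoff c k (A *v v) \<partial>std_gaussian) \<longlonglongrightarrow> measure std_gaussian {v. \<forall>j. 0 < (A *v v) $ j}"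
proof -
  have [measurable]: "cutoff c k \<in> borel_measurable borel" for k
    unfolding cutoff_def by (intro borel_measurable_continuous_onI continuous_intros)
  have meas [measurable]: "{v. \<forall>j. 0 < (A *v v) $ j} \<in> sets borel"
  proof -
    have "open {v. \<forall>j. 0 < (A *v v) $ j}"
      unfolding Collect_all_eq
      by (intro open_INT open_Collect_less continuous_intros linear_continuous_on ballI) simp_all
    then show ?thesis by simp
  qed
  have "(\<lambda>k. \<integral>v. cutoff c k (A *v v) \<partial>std_gaussian) \<longlonglongrightarrow> (\<integral>v. indicator {v. \<forall>j. 0 < (A *v v) $ j} v \<partial>std_gaussian)"
  proof (rule integral_dominated_convergence [where w = "\<lambda>_. 1"])
    have "AE v in std_gaussian. \<forall>j\<in>UNIV. (A *v v) $ j \<noteq> 0"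
      by (intro AE_finite_allI AE_nonzero) simp
    then show "AE v in std_gaussian. (\<lambda>k. cutoff c k (A *v v)) \<longlonglongrightarrow> indicator {v. \<forall>j. 0 < (A *v v) $ j} v"
    proof eventually_elim
      case (elim v)
      then have "(\<lambda>k. cutoff c k (A *v v)) \<longlonglongrightarrow> (\<Prod>j\<in>UNIV. of_bool (0 < (A *v v) $ j))"
        unfolding cutoff_def by (intro tendsto_prod clamp01_sin_tendsto) auto
      also have "(\<Prod>j\<in>UNIV. of_bool (0 < (A *v v) $ j)) = (indicator {v. \<forall>j. 0 < (A *v v) $ j} v :: real)"
        by (auto simp: indicator_def of_bool_def intro: prod_zero)
      finally show ?case .
    qed
  qed (auto simp: cutoff_bounds)
  then show ?thesis by simp
qed

theorem clt_orthant:
  "(\<lambda>n. expect n (\<lambda>v. of_bool (\<forall>j. 0 < clt_sum n v $ j))) \<longlonglongrightarrow> measure std_gaussian {v. \<forall>j. 0 < (A *v v) $ j}"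
  (is "?E \<longlonglongrightarrow> ?L")
proof -
  define T where "T k = 2 * real CARD('n) * exp 1 * exp (- real k)" for k
  have T: "T \<longlonglongrightarrow> 0" unfolding T_def by real_asymp
  have "eventually (\<lambda>n. ?E n < ?L + e) sequentially" if e: "e > 0" for e
  proof -
    have "(\<lambda>k. (\<integral>v. cutoff 1 k (A *v v) \<partial>std_gaussian) + T k) \<longlonglongrightarrow> ?L + 0"
      by (intro tendsto_add integral_cutoff_tendsto T)
    then have "eventually (\<lambda>k. (\<integral>v. cutoff 1 k (A *v v) \<partial>std_gaussian) + T k < ?L + e) sequentially"
      using e by (intro order_tendstoD(2)) auto
    \<comment> \<open>\<open>k\<close> is fixed here, before \<open>n\<close> grows: the tail costs
      at most \<open>T k\<close> for every \<open>n\<close>, so only convergence for this one cutoff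
      remains to be used.\<close>
    from eventually_happens' [OF sequentially_bot eventually_conj [OF eventually_gt_at_top [of 0] this]]
    obtain k where k: "k > 0" "(\<integral>v. cutoff 1 k (A *v v) \<partial>std_gaussian) + T k < ?L + e"
      by blast
    then have "eventually (\<lambda>n. expect n (\<lambda>v. cutoff 1 k (clt_sum n v)) < ?L + e - T k) sequentially"
      by (intro order_tendstoD(2) [OF expect_cutoff_tendsto]) simp
    then show ?thesis
    proof eventually_elim
      case (elim n)
      have "?E n \<le> expect n (\<lambda>v. cutoff 1 k (clt_sum n v) + tail k (clt_sum n v))"
        by (intro iid_expectation_mono p_nonneg orthant_le_cutoff k)
      also have "\<dots> \<le> expect n (\<lambda>v. cutoff 1 k (clt_sum n v)) + T k"
        using expect_tail_le [of n k] by (simp add: iid_expectation_add T_def)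
      finally show ?case using elim by simp
    qed
  qed
  moreover have "eventually (\<lambda>n. ?E n > ?L - e) sequentially" if e: "e > 0" for e
  proof -
    have "(\<lambda>k. (\<integral>v. cutoff 0 k (A *v v) \<partial>std_gaussian) - T k) \<longlonglongrightarrow> ?L - 0"
      by (intro tendsto_diff integral_cutoff_tendsto T)
    then have "eventually (\<lambda>k. (\<integral>v. cutoff 0 k (A *v v) \<partial>std_gaussian) - T k > ?L - e) sequentially"
      using e by (intro order_tendstoD(1)) auto
    from eventually_happens' [OF sequentially_bot eventually_conj [OF eventually_gt_at_top [of 0] this]]
    obtain k where k: "k > 0" "(\<integral>v. cutoff 0 k (A *v v) \<partial>std_gaussian) - T k > ?L - e"
      by blast
    then have "eventually (\<lambda>n. expect n (\<lambda>v. cutoff 0 k (clt_sum n v)) > ?L - e + T k) sequentially"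
      by (intro order_tendstoD(1) [OF expect_cutoff_tendsto]) simp
    then show ?thesis
    proof eventually_elim
      case (elim n)
      have "expect n (\<lambda>v. cutoff 0 k (clt_sum n v)) \<le>
          expect n (\<lambda>v. of_bool (\<forall>j. 0 < clt_sum n v $ j) + tail k (clt_sum n v))"
        by (intro iid_expectation_mono p_nonneg cutoff_le_orthant k)
      also have "\<dots> \<le> ?E n + T k"
        using expect_tail_le [of n k] by (simp add: iid_expectation_add T_def)
      finally show ?case using elim by simp
    qed
  qed
  ultimately have bounds: "eventually (\<lambda>n. ?E n < ?L + e) sequentially" "eventually (\<lambda>n. ?E n > ?L - e) sequentially"
    if "e > 0" for e
    using that by blast+
  show ?thesis
  proof (rule order_tendstoI)
    show "eventually (\<lambda>n. ?E n < a) sequentially" if "?L < a" for a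
      using bounds(1) [of "a - ?L"] that by simp
    show "eventually (\<lambda>n. a < ?E n) sequentially" if "a < ?L" for a
      using bounds(2) [of "?L - a"] that by simp
  qed
qed

end

section \<open>Cumulant generating functions\<close>

definition cgf :: "'a set \<Rightarrow> ('a \<Rightarrow> real) \<Rightarrow> ('a \<Rightarrow> real^'n) \<Rightarrow> real^'n \<Rightarrow> real" where
  "cgf R p e t = ln (\<Sum>r\<in>R. p r * exp (e r \<bullet> t))"

text \<open>Strictness comes from squaring the weak inequality at \<open>x / 2\<close>, which gains
  the term \<open>x^2 / 4\<close>.\<close>

lemma exp_gt_add_one_self:
  fixes x :: real
  assumes "x \<noteq> 0"
  shows "1 + x < exp x"
proof (cases "1 + x / 2 \<ge> 0")
  case True
  have "1 + x < (1 + x / 2)\<^sup>2" using assms by (auto simp: power2_eq_square algebra_simps zero_less_mult_iff neq_iff)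
  also have "\<dots> \<le> (exp (x / 2))\<^sup>2" using True by (intro power_mono exp_ge_add_one_self) auto
  also have "\<dots> = exp x" by (simp add: exp_double [symmetric])
  finally show ?thesis .
next
  case False
  then have "1 + x < 0" by simp
  then show ?thesis using exp_gt_zero [of x] by linarith
qed

locale positive_weights =
  fixes R :: "'a set" and p :: "'a \<Rightarrow> real" and e :: "'a \<Rightarrow> real^'n"
  assumes finite: "finite R" and nonempty: "R \<noteq> {}" and pos: "\<And>r. r \<in> R \<Longrightarrow> 0 < p r"
begin

text \<open>Divided by \<open>mgf (\<lambda>_. 1) t\<close>, this is the mean of \<open>f\<close>
  under the weights tilted by \<open>exp (e r \<bullet> t)\<close>. Carrying \<open>f\<close> along
  closes the family under partial derivatives: differentiation along \<open>axis i 1\<close>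
  multiplies \<open>f\<close> by the \<open>i\<close>-th coordinate of \<open>e\<close>.\<close>

definition mgf :: "('a \<Rightarrow> real) \<Rightarrow> real^'n \<Rightarrow> real" where
  "mgf f t = (\<Sum>r\<in>R. p r * f r * exp (e r \<bullet> t))"

lemma mgf_pos: "mgf (\<lambda>_. 1) t > 0"
  unfolding mgf_def using finite nonempty pos by (intro sum_pos) auto

lemma cgf_eq: "cgf R p e = (\<lambda>t. ln (mgf (\<lambda>_. 1) t))"
  by (rule ext) (simp add: cgf_def mgf_def)

lemma DERIV_mgf:
  "((\<lambda>h. mgf f (t + h *\<^sub>R axis i 1)) has_real_derivative mgf (\<lambda>r. f r * e r $ i) t) (at 0)"
  unfolding mgf_def
  by (auto intro!: derivative_eq_intros sum.cong simp: inner_add_right inner_axis)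

lemma DERIV_cgf:
  "((\<lambda>h. cgf R p e (t + h *\<^sub>R axis i 1)) has_real_derivative mgf (\<lambda>r. e r $ i) t / mgf (\<lambda>_. 1) t) (at 0)"
  unfolding cgf_eq using mgf_pos [of t] DERIV_mgf [of "\<lambda>_. 1" t i]
  by (auto intro!: derivative_eq_intros)

lemma partial_deriv_cgf: "partial_deriv i (cgf R p e) = (\<lambda>t. mgf (\<lambda>r. e r $ i) t / mgf (\<lambda>_. 1) t)"
  unfolding partial_deriv_def using DERIV_cgf by (auto intro!: DERIV_imp_deriv)

text \<open>The quotient rule produces the covariance of \<open>e\<close> under the tilted weights,
  which at \<open>t = 0\<close> are the original ones.\<close>

lemma hessian_cgf:
  "hessian (cgf R p e) t $ i $ j =
    (mgf (\<lambda>r. e r $ j * e r $ i) t * mgf (\<lambda>_. 1) t - mgf (\<lambda>r. e r $ j) t * mgf (\<lambda>r. e r $ i) t) / (mgf (\<lambda>_. 1) t)\<^sup>2"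
proof -
  have "((\<lambda>h. mgf (\<lambda>r. e r $ j) (t + h *\<^sub>R axis i 1) / mgf (\<lambda>_. 1) (t + h *\<^sub>R axis i 1)) has_real_derivative
    (mgf (\<lambda>r. e r $ j * e r $ i) t * mgf (\<lambda>_. 1) t - mgf (\<lambda>r. e r $ j) t * mgf (\<lambda>r. e r $ i) t) / (mgf (\<lambda>_. 1) t)\<^sup>2) (at 0)"
    using DERIV_divide [OF DERIV_mgf [of "\<lambda>r. e r $ j" t i] DERIV_mgf [of "\<lambda>_. 1" t i]] mgf_pos [of t]
    by (simp add: power2_eq_square)
  then show ?thesis
    unfolding hessian_def partial_deriv_cgf by (simp add: partial_deriv_def DERIV_imp_deriv)
qed

lemma maximizer_gradient:
  assumes "\<And>s. - cgf R p e s + b \<bullet> s \<le> - cgf R p e t + b \<bullet> t"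
  shows "b $ i * mgf (\<lambda>_. 1) t = mgf (\<lambda>r. e r $ i) t"
proof -
  have "((\<lambda>h. - cgf R p e (t + h *\<^sub>R axis i 1) + b \<bullet> (t + h *\<^sub>R axis i 1)) has_real_derivative
      - (mgf (\<lambda>r. e r $ i) t / mgf (\<lambda>_. 1) t) + b $ i) (at 0)"
    by (auto intro!: derivative_eq_intros DERIV_cgf simp: inner_add_right inner_axis)
  then have "- (mgf (\<lambda>r. e r $ i) t / mgf (\<lambda>_. 1) t) + b $ i = 0"
    by (rule DERIV_local_max [where d = 1]) (use assms in auto)
  then show ?thesis using mgf_pos [of t] by (simp add: field_simps)
qed

text \<open>The tangent line of \<open>exp\<close> at the tilted mean bounds the moment generating function from below,
  so a maximizer is strict.\<close>
lemma maximizer_unique: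
  assumes max: "\<And>u. - cgf R p e u + b \<bullet> u \<le> - cgf R p e s + b \<bullet> s"
      "\<And>u. - cgf R p e u + b \<bullet> u \<le> - cgf R p e t + b \<bullet> t"
    and separating: "\<And>c d. (\<And>r. r \<in> R \<Longrightarrow> e r \<bullet> c = d) \<Longrightarrow> c = 0"
  shows "s = t"
proof (rule ccontr)
  assume "s \<noteq> t"
  define c where "c = t - s"
  have "c \<noteq> 0" using \<open>s \<noteq> t\<close> by (simp add: c_def)
  \<comment> \<open>A function \<open>e r \<bullet> c\<close> that is not constant on
    \<open>R\<close> differs from the tilted mean \<open>b \<bullet> c\<close> somewhere, and there
    the tangent bound is strict.\<close>
  with separating obtain r0 where r0: "r0 \<in> R" "e r0 \<bullet> c \<noteq> b \<bullet> c" by blast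
  have mean: "(\<Sum>r\<in>R. p r * exp (e r \<bullet> s) * (e r \<bullet> c)) = (b \<bullet> c) * mgf (\<lambda>_. 1) s"
  proof -
    have "(\<Sum>r\<in>R. p r * exp (e r \<bullet> s) * (e r \<bullet> c)) = (\<Sum>r\<in>R. \<Sum>i\<in>UNIV. c $ i * (p r * e r $ i * exp (e r \<bullet> s)))"
      by (simp add: inner_vec_def [of _ c] sum_distrib_left mult_ac)
    also have "\<dots> = (\<Sum>i\<in>UNIV. \<Sum>r\<in>R. c $ i * (p r * e r $ i * exp (e r \<bullet> s)))"
      by (rule sum.swap)
    also have "\<dots> = (\<Sum>i\<in>UNIV. c $ i * mgf (\<lambda>r. e r $ i) s)"
      by (simp add: mgf_def sum_distrib_left)
    also have "\<dots> = (\<Sum>i\<in>UNIV. c $ i * (b $ i * mgf (\<lambda>_. 1) s))"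
      by (simp add: maximizer_gradient [OF max(1)])
    also have "\<dots> = (b \<bullet> c) * mgf (\<lambda>_. 1) s"
      by (simp add: inner_vec_def sum_distrib_left mult_ac)
    finally show ?thesis .
  qed
  have "exp (b \<bullet> c) * mgf (\<lambda>_. 1) s =
      exp (b \<bullet> c) * (\<Sum>r\<in>R. p r * exp (e r \<bullet> s) * (1 + (e r \<bullet> c - b \<bullet> c)))"
    using mean by (simp add: mgf_def algebra_simps sum.distrib sum_subtractf sum_distrib_left)
  also have "\<dots> = (\<Sum>r\<in>R. p r * exp (e r \<bullet> s) * (exp (b \<bullet> c) * (1 + (e r \<bullet> c - b \<bullet> c))))"
    by (simp add: sum_distrib_left mult_ac)
  also have "\<dots> < (\<Sum>r\<in>R. p r * exp (e r \<bullet> s) * (exp (b \<bullet> c) * exp (e r \<bullet> c - b \<bullet> c)))"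
  proof (rule sum_strict_mono_ex1 [OF finite])
    show "\<forall>r\<in>R. p r * exp (e r \<bullet> s) * (exp (b \<bullet> c) * (1 + (e r \<bullet> c - b \<bullet> c)))
        \<le> p r * exp (e r \<bullet> s) * (exp (b \<bullet> c) * exp (e r \<bullet> c - b \<bullet> c))"
      using pos by (intro ballI mult_left_mono exp_ge_add_one_self) (auto intro: less_imp_le)
    show "\<exists>r\<in>R. p r * exp (e r \<bullet> s) * (exp (b \<bullet> c) * (1 + (e r \<bullet> c - b \<bullet> c)))
        < p r * exp (e r \<bullet> s) * (exp (b \<bullet> c) * exp (e r \<bullet> c - b \<bullet> c))"
      using r0 pos by (intro bexI [of _ r0] mult_strict_left_mono exp_gt_add_one_self) auto
  qed
  also have "\<dots> = mgf (\<lambda>_. 1) t"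
  proof -
    have "exp (e r \<bullet> s) * (exp (b \<bullet> c) * exp (e r \<bullet> c - b \<bullet> c)) = exp (e r \<bullet> t)" for r
      by (simp add: mult_exp_exp c_def inner_diff_right)
    then show ?thesis by (simp add: mgf_def mult.assoc)
  qed
  finally have "ln (exp (b \<bullet> c) * mgf (\<lambda>_. 1) s) < ln (mgf (\<lambda>_. 1) t)"
    using mgf_pos by (subst ln_less_cancel_iff) auto
  then have "b \<bullet> c + cgf R p e s < cgf R p e t"
    using mgf_pos [of s] by (simp add: ln_mult cgf_eq)
  then show False
    using max(1) [of t] max(2) [of s] by (simp add: c_def inner_diff_right)
qed

section \<open>Existence of the saddle point\<close>

lemma ln_add_inner_le_cgf:
  assumes "r \<in> R"
  shows "ln (p r) + e r \<bullet> t \<le> cgf R p e t"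
proof -
  have "p r * exp (e r \<bullet> t) \<le> (\<Sum>r\<in>R. p r * exp (e r \<bullet> t))"
    using assms finite pos by (intro member_le_sum) (auto intro: less_imp_le)
  moreover have "0 < p r * exp (e r \<bullet> t)" using pos [OF assms] by simp
  ultimately have "ln (p r * exp (e r \<bullet> t)) \<le> cgf R p e t"
    unfolding cgf_def by (subst ln_le_cancel_iff) auto
  then show ?thesis using pos [OF assms] by (simp add: ln_mult)
qed

text \<open>The point \<open>b\<close> is interior to the cube spanned by the values of
  \<open>e\<close>. Keeping only the term of the vertex that marks the positive coordinates of
  \<open>t\<close> shows that the objective falls at least linearly in \<open>norm t\<close>, so a
  maximizer over a large ball is global.\<close>

lemma maximizer_exists:
  assumes b: "\<And>j. 0 < b $ j" "\<And>j. b $ j < 1"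
    and vertices: "\<And>X. \<exists>r\<in>R. e r = (\<chi> j. of_bool (j \<in> X))"
  shows "\<exists>t. \<forall>s. - cgf R p e s + b \<bullet> s \<le> - cgf R p e t + b \<bullet> t"
proof -
  let ?f = "\<lambda>t. - cgf R p e t + b \<bullet> t"
  \<comment> \<open>The smallest distance from \<open>b\<close> to a facet of the cube; it becomes
    the rate of decay.\<close>
  define \<delta> where "\<delta> = Min (range (\<lambda>j. min (b $ j) (1 - b $ j)))"
  have \<delta>: "\<delta> > 0" unfolding \<delta>_def using b by (subst Min_gr_iff) auto
  have \<delta>_le: "\<delta> \<le> b $ j" "\<delta> \<le> 1 - b $ j" for j
  proof -
    have "\<delta> \<le> min (b $ j) (1 - b $ j)" unfolding \<delta>_def by (rule Min_le) auto
    then show "\<delta> \<le> b $ j" "\<delta> \<le> 1 - b $ j" by auto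
  qed
  define L where "L = (\<Sum>r\<in>R. \<bar>ln (p r)\<bar>)"
  have coercive: "?f t \<le> L - \<delta> * norm t" for t
  proof -
    obtain r where r: "r \<in> R" "e r = (\<chi> j. of_bool (j \<in> {j. t $ j > 0}))" using vertices by blast
    have "\<bar>ln (p r)\<bar> \<le> L" unfolding L_def using r finite by (intro member_le_sum) auto
    then have "?f t \<le> L + (b \<bullet> t - e r \<bullet> t)" using ln_add_inner_le_cgf [OF r(1), of t] by simp
    also have "b \<bullet> t - e r \<bullet> t = (\<Sum>j\<in>UNIV. b $ j * t $ j - of_bool (t $ j > 0) * t $ j)"
      by (simp add: inner_vec_def r(2) sum_subtractf)
    also have "\<dots> \<le> (\<Sum>j\<in>UNIV. - \<delta> * \<bar>t $ j\<bar>)"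
    proof (rule sum_mono)
      fix j
      show "b $ j * t $ j - of_bool (t $ j > 0) * t $ j \<le> - \<delta> * \<bar>t $ j\<bar>"
      proof (cases "t $ j > 0")
        case True
        then show ?thesis using mult_right_mono [OF \<delta>_le(2) [of j], of "t $ j"] by (simp add: algebra_simps)
      next
        case False
        then show ?thesis using mult_right_mono_neg [OF \<delta>_le(1) [of j], of "t $ j"] by simp
      qed
    qed
    also have "\<dots> = - \<delta> * (\<Sum>j\<in>UNIV. \<bar>t $ j\<bar>)" by (simp only: sum_distrib_left)
    also have "\<dots> \<le> - \<delta> * norm t" using norm_le_l1_cart [of t] \<delta> by simp
    finally show ?thesis by simp
  qed
  \<comment> \<open>Outside this radius the coercive bound is at most
    \<open>- \<bar>?f 0\<bar>\<close>, so the objective does not exceed its value at the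
    centre.\<close>
  define B where "B = (L + \<bar>?f 0\<bar>) / \<delta>"
  have "B \<ge> 0" unfolding B_def L_def using \<delta> by (intro divide_nonneg_pos add_nonneg_nonneg sum_nonneg) auto
  have "continuous_on (cball 0 B) ?f"
  proof -
    have "mgf (\<lambda>_. 1) t \<noteq> 0" for t using mgf_pos [of t] by simp
    moreover have "continuous_on (cball 0 B) (mgf (\<lambda>_. 1))"
      unfolding mgf_def by (intro continuous_intros)
    ultimately show ?thesis unfolding cgf_eq by (intro continuous_intros) auto
  qed
  then obtain t where t: "t \<in> cball 0 B" "\<And>s. s \<in> cball 0 B \<Longrightarrow> ?f s \<le> ?f t"
    using continuous_attains_sup [OF compact_cball, of 0 B ?f] \<open>B \<ge> 0\<close> by force
  have "?f s \<le> ?f t" for s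
  proof (cases "s \<in> cball 0 B")
    case False
    then have "L + \<bar>?f 0\<bar> \<le> \<delta> * norm s" using \<delta> by (simp add: B_def field_simps)
    then have "?f s \<le> ?f 0" using coercive [of s] by linarith
    also have "\<dots> \<le> ?f t" using t(2) [of 0] \<open>B \<ge> 0\<close> by simp
    finally show ?thesis .
  qed (rule t)
  then show ?thesis by blast
qed

end

section \<open>Rankings\<close>

lemma finite_rankings: "finite (rankings :: ('n::finite option \<Rightarrow> nat) set)"
proof (rule finite_subset)
  show "rankings \<subseteq> (PiE UNIV (\<lambda>_. {..<CARD('n option)}) :: ('n option \<Rightarrow> nat) set)"
    by (auto simp: rankings_def bij_betw_def)
  show "finite (PiE UNIV (\<lambda>_. {..<CARD('n option)}) :: ('n option \<Rightarrow> nat) set)"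
    by (intro finite_PiE) auto
qed

text \<open>Place \<open>X\<close> first, then \<open>m\<close>, then the remaining adversaries.
  This realizes all vertices of the cube by rankings, hence with positive probability under the
  hypotheses on \<open>p\<close>.\<close>

lemma ex_ranking_above_m:
  fixes X :: "'n::finite set"
  shows "\<exists>r\<in>rankings. above_m r = X"
proof -
  obtain f where f: "bij_betw f X {..<card X}"
    using ex_bij_betw_finite_nat [of X] by (auto simp: atLeast0LessThan)
  obtain g where g: "bij_betw g (- X) {..<card (- X)}"
    using ex_bij_betw_finite_nat [of "- X"] by (auto simp: atLeast0LessThan)
  have fX: "f j < card X" if "j \<in> X" for j using f that by (auto simp: bij_betw_def)
  have gX: "g j < card (- X)" if "j \<notin> X" for j using g that by (auto simp: bij_betw_def)
  have card: "CARD('n option) = Suc (card X + card (- X))"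
    using card_Un_disjoint [of X "- X"] by (simp add: card_UNIV_option)
  define r where "r = (\<lambda>x. case x of None \<Rightarrow> card X | Some j \<Rightarrow> if j \<in> X then f j else Suc (card X + g j))"
  have "inj r"
  proof (rule injI)
    fix a b assume "r a = r b"
    then show "a = b"
      using f g fX gX
      by (cases a; cases b) (auto simp: r_def bij_betw_def split: if_splits dest: inj_onD, (metis less_irrefl not_add_less1 Suc_lessD less_SucI)+)
  qed
  moreover have "range r \<subseteq> {..<CARD('n option)}"
  proof
    fix y assume "y \<in> range r"
    then obtain x where "y = r x" by blast
    then show "y \<in> {..<CARD('n option)}"
      using fX gX unfolding card by (cases x) (auto simp: r_def intro!: less_SucI trans_less_add1)
  qed
  ultimately have "range r = {..<CARD('n option)}"
    by (intro card_subset_eq) (simp_all add: card_image del: card_UNIV_option)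
  with \<open>inj r\<close> have "r \<in> rankings"
    by (simp add: rankings_def bij_betw_def)
  moreover have "above_m r = X"
    using fX by (auto simp: above_m_def r_def split: if_splits)
  ultimately show ?thesis by blast
qed

definition adv_vec :: "('n::finite option \<Rightarrow> nat) \<Rightarrow> real^'n" where
  "adv_vec r = (\<chi> j. of_bool (j \<in> above_m r))"

text \<open>Regrouping the rankings by their set \<open>above_m\<close> turns the polynomial at
  \<open>exp t\<close> into the moment generating function of the indicator vector
  \<open>adv_vec\<close>.\<close>

lemma Kfun_eq_cgf: "Kfun p = cgf rankings p (adv_vec :: ('n::finite option \<Rightarrow> nat) \<Rightarrow> real^'n)"
proof
  fix t :: "real^'n"
  have "Ppoly p (\<chi> j. exp (t $ j)) =
      (\<Sum>X\<in>UNIV. \<Sum>r\<in>{r \<in> rankings. above_m r = X}. p r * (\<Prod>j\<in>above_m r. exp (t $ j)))"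
    unfolding Ppoly_def pX_def by (auto simp: sum_distrib_right intro!: sum.cong)
  also have "\<dots> = (\<Sum>r\<in>rankings. p r * (\<Prod>j\<in>above_m r. exp (t $ j)))"
    by (intro sum.group finite_rankings) auto
  also have "\<dots> = (\<Sum>r\<in>rankings. p r * exp (adv_vec r \<bullet> t))"
  proof -
    have "adv_vec r \<bullet> t = (\<Sum>j\<in>above_m r. t $ j)" for r :: "'n option \<Rightarrow> nat"
      by (simp add: inner_vec_def adv_vec_def of_bool_def if_distrib [of "\<lambda>x. x * _"] sum.If_cases cong: if_cong)
    then show ?thesis by (simp add: exp_sum)
  qed
  finally show "Kfun p t = cgf rankings p adv_vec t" by (simp add: Kfun_def cgf_def)
qed

text \<open>Positions are injective, so there are no ties: every adversary not above
  \<open>m\<close> is below it.\<close>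

lemma card_voters_eq_sum:
  fixes n :: nat
  assumes "\<And>i. i < n \<Longrightarrow> v i \<in> rankings"
  shows "real (card {i \<in> {..<n}. v i None < v i (Some j)}) = (\<Sum>i<n. 1 - adv_vec (v i) $ j)"
proof -
  have "1 - adv_vec (v i) $ j = of_bool (v i None < v i (Some j))" if "i < n" for i
  proof -
    have "inj (v i)" using assms [OF that] by (auto simp: rankings_def bij_betw_def)
    then have "v i None \<noteq> v i (Some j)" by (metis injD option.distinct(1))
    then show ?thesis by (auto simp: adv_vec_def above_m_def)
  qed
  moreover have "{i \<in> {..<n}. v i None < v i (Some j)} = {..<n} \<inter> {i. v i None < v i (Some j)}" by auto
  ultimately show ?thesis by (simp add: sum_of_bool_eq)
qed

section \<open>The limit of the winning probability\<close>

theorem theorem3: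
  fixes p :: "('n::finite option \<Rightarrow> nat) \<Rightarrow> real"
    and \<alpha> :: "real^'n"
  assumes p_pos: "\<And>r. r \<in> rankings \<Longrightarrow> p r > 0"
    and p_sum: "(\<Sum>r\<in>rankings. p r) = 1"
    and \<alpha>_range: "\<And>j. 0 < \<alpha> $ j \<and> \<alpha> $ j < 1"
    and critical: "\<And>j. zeta p \<alpha> $ j = 1"
  shows "(\<lambda>n. prob_winner p \<alpha> n) \<longlonglongrightarrow>
    (let H = hessian (Kfun p) (tau p \<alpha>) in
      1 / sqrt ((2 * pi) ^ CARD('n) * det H) *
      (LINT u : {u. \<forall>j. 0 < u $ j} | lborel. exp (- (u \<bullet> (matrix_inv H *v u)) / 2)))"
proof -
  define \<beta> :: "real^'n" where "\<beta> = (\<chi> j. 1 - \<alpha> $ j)"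
  have \<beta>: "0 < \<beta> $ j" "\<beta> $ j < 1" for j using \<alpha>_range [of j] by (auto simp: \<beta>_def)
  have p_nonneg: "0 \<le> p r" if "r \<in> rankings" for r using p_pos [OF that] by simp
  have vertex: "\<exists>r\<in>rankings. adv_vec r = (\<chi> j. of_bool (j \<in> X))" for X :: "'n set"
    using ex_ranking_above_m [of X] by (auto simp: adv_vec_def)
  \<comment> \<open>The empty set forces \<open>d = 0\<close>, and then the singleton
    \<open>{j}\<close> forces \<open>c $ j = 0\<close>.\<close>
  have separating: "c = 0" if "\<And>r. r \<in> rankings \<Longrightarrow> adv_vec r \<bullet> c = d" for c :: "real^'n" and d
  proof (subst vec_eq_iff, intro allI)
    fix j
    obtain r0 where r0: "r0 \<in> rankings" "adv_vec r0 = (\<chi> j. of_bool (j \<in> {}) :: real^'n)"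
      using vertex [of "{}"] by blast
    obtain r1 where r1: "r1 \<in> rankings" "adv_vec r1 = (\<chi> i. of_bool (i \<in> {j}) :: real^'n)"
      using vertex [of "{j}"] by blast
    have "adv_vec r0 = 0" "adv_vec r1 = axis j 1"
      using r0(2) r1(2) by (auto simp: vec_eq_iff axis_def)
    then show "c $ j = 0 $ j"
      using that [OF r0(1)] that [OF r1(1)] by (simp add: inner_axis')
  qed
  interpret positive_weights rankings p adv_vec
    using finite_rankings vertex p_pos by unfold_locales blast+
  have obj: "saddle_obj p \<alpha> t = - cgf rankings p adv_vec t + \<beta> \<bullet> t" for t
    by (simp add: saddle_obj_def Kfun_eq_cgf \<beta>_def)
  obtain t where t: "\<forall>s. saddle_obj p \<alpha> s \<le> saddle_obj p \<alpha> t"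
    unfolding obj using maximizer_exists [OF \<beta> vertex] by blast
  have "\<exists>!t. \<forall>s. saddle_obj p \<alpha> s \<le> saddle_obj p \<alpha> t"
  proof (rule ex1I)
    show "\<forall>s. saddle_obj p \<alpha> s \<le> saddle_obj p \<alpha> t" by (rule t)
    fix u assume u: "\<forall>s. saddle_obj p \<alpha> s \<le> saddle_obj p \<alpha> u"
    show "u = t"
    proof (rule maximizer_unique [of \<beta>])
      show "- cgf rankings p adv_vec w + \<beta> \<bullet> w \<le> - cgf rankings p adv_vec u + \<beta> \<bullet> u" for w
        using spec [OF u, of w] by (simp only: obj)
      show "- cgf rankings p adv_vec w + \<beta> \<bullet> w \<le> - cgf rankings p adv_vec t + \<beta> \<bullet> t" for w
        using spec [OF t, of w] by (simp only: obj)
    qed (rule separating)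
  qed
  from theI' [OF this] have tau_max: "saddle_obj p \<alpha> s \<le> saddle_obj p \<alpha> (tau p \<alpha>)" for s
    unfolding tau_def by blast
  \<comment> \<open>At the origin the exponential tilt is trivial, so \<open>mgf\<close> becomes the
    plain expectation under \<open>p\<close> and the gradient equation fixes the mean of
    \<open>adv_vec\<close>.\<close>
  have tau0: "tau p \<alpha> = 0"
    using critical by (simp add: zeta_def vec_eq_iff)
  have mgf0: "mgf f 0 = (\<Sum>r\<in>rankings. p r * f r)" for f
    by (simp add: mgf_def)
  have \<beta>_mean: "\<beta> $ j = (\<Sum>r\<in>rankings. p r * adv_vec r $ j)" for j
    using maximizer_gradient [of \<beta> 0 j] tau_max by (simp add: obj tau0 mgf0 p_sum)
  \<comment> \<open>Since \<open>\<beta>\<close> is \<open>1 - \<alpha>\<close>, coordinate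
    \<open>j\<close> is the indicator that \<open>m\<close> beats \<open>j\<close>, minus
    \<open>\<alpha> $ j\<close>; with this sign, winning means a positive sum.\<close>
  define y where "y r = \<beta> - adv_vec r" for r
  have y_mean: "(\<Sum>r\<in>rankings. p r *\<^sub>R y r) = 0"
    by (simp add: vec_eq_iff y_def \<beta>_mean [symmetric] algebra_simps sum_subtractf sum_distrib_right [symmetric] p_sum)
  define H where "H = hessian (Kfun p) (tau p \<alpha>)"
  have H: "H $ i $ j = (\<Sum>r\<in>rankings. p r * (y r $ i * y r $ j))" for i j
  proof -
    have "H $ i $ j = (\<Sum>r\<in>rankings. p r * (adv_vec r $ j * adv_vec r $ i)) - \<beta> $ j * \<beta> $ i"
      unfolding H_def Kfun_eq_cgf tau0 hessian_cgf mgf0 by (simp add: p_sum \<beta>_mean)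
    also have "\<dots> = (\<Sum>r\<in>rankings. p r * (y r $ i * y r $ j))"
    proof -
      have "p r * (y r $ i * y r $ j) = (\<beta> $ i * \<beta> $ j) * p r - \<beta> $ i * (p r * adv_vec r $ j)
          - \<beta> $ j * (p r * adv_vec r $ i) + p r * (adv_vec r $ j * adv_vec r $ i)" for r
        by (simp add: y_def algebra_simps)
      then show ?thesis
        by (simp only: sum.distrib sum_subtractf sum_distrib_left [symmetric] p_sum \<beta>_mean [symmetric])
    qed
    finally show ?thesis .
  qed
  have cov: "(\<Sum>r\<in>rankings. p r * (a \<bullet> y r)\<^sup>2) = a \<bullet> (H *v a)" for a
  proof -
    have "a \<bullet> (H *v a) = (\<Sum>i\<in>UNIV. \<Sum>j\<in>UNIV. \<Sum>r\<in>rankings. p r * ((a $ i * y r $ i) * (a $ j * y r $ j)))"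
      by (simp add: inner_vec_def matrix_vector_mult_def H sum_distrib_left sum_distrib_right mult_ac)
    also have "\<dots> = (\<Sum>i\<in>UNIV. \<Sum>r\<in>rankings. \<Sum>j\<in>UNIV. p r * ((a $ i * y r $ i) * (a $ j * y r $ j)))"
      by (intro sum.cong refl sum.swap)
    also have "\<dots> = (\<Sum>r\<in>rankings. \<Sum>i\<in>UNIV. \<Sum>j\<in>UNIV. p r * ((a $ i * y r $ i) * (a $ j * y r $ j)))"
      by (rule sum.swap)
    also have "\<dots> = (\<Sum>r\<in>rankings. p r * (a \<bullet> y r)\<^sup>2)"
      unfolding inner_vec_def inner_real_def power2_eq_square sum_product by (simp only: sum_distrib_left)
    finally show ?thesis by simp
  qed
  have H_sym: "transpose H = H"
    by (simp add: vec_eq_iff transpose_def H mult.commute)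
  \<comment> \<open>A direction of zero variance would make \<open>adv_vec r \<bullet> a\<close>
    constant over all rankings, which \<open>separating\<close> excludes for nonzero
    \<open>a\<close>.\<close>
  have H_pos: "0 < a \<bullet> (H *v a)" if a: "a \<noteq> 0" for a
  proof -
    obtain r where r: "r \<in> rankings" "adv_vec r \<bullet> a \<noteq> \<beta> \<bullet> a"
      using separating [of a "\<beta> \<bullet> a"] a by blast
    have "0 < (\<Sum>r\<in>rankings. p r * (a \<bullet> y r)\<^sup>2)"
    proof (rule sum_pos2 [OF finite_rankings r(1)])
      show "0 < p r * (a \<bullet> y r)\<^sup>2"
        using r p_pos by (auto simp: y_def inner_diff_right inner_commute)
    qed (simp add: p_nonneg)
    then show ?thesis by (simp add: cov)
  qed
  obtain A where A: "det A \<noteq> 0" "H = A ** transpose A"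
    by (rule posdef_factorization [OF H_sym H_pos])
  have y_bound: "\<bar>y r $ j\<bar> \<le> 1" for r j
    using \<beta> [of j] by (simp add: y_def adv_vec_def)
  have y_cov: "(\<Sum>r\<in>rankings. p r * (a \<bullet> y r)\<^sup>2) = a \<bullet> ((A ** transpose A) *v a)" for a
    unfolding A(2) [symmetric] by (rule cov)
  have voters: "finite_iid_vector rankings p y A"
  proof (rule finite_iid_vector.intro)
    show "finite (rankings :: ('n option \<Rightarrow> nat) set)" by (rule finite_rankings)
    show "0 \<le> p r" if "r \<in> rankings" for r using that by (rule p_nonneg)
    show "(\<Sum>r\<in>rankings. p r) = 1" by (rule p_sum)
    show "(\<Sum>r\<in>rankings. p r *\<^sub>R y r) = 0" by (rule y_mean)
    show "\<bar>y r $ j\<bar> \<le> 1" for r j by (rule y_bound)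
    show "(\<Sum>r\<in>rankings. p r * (a \<bullet> y r)\<^sup>2) = a \<bullet> ((A ** transpose A) *v a)" for a by (rule y_cov)
    show "det A \<noteq> 0" by (rule A(1))
  qed
  let ?S = "finite_iid_vector.clt_sum y"
  have winner: "alpha_winner \<alpha> n v \<longleftrightarrow> (\<forall>j. 0 < ?S n v $ j)"
    if n: "n > 0" and v: "v \<in> PiE {..<n} (\<lambda>_. rankings)" for n v
  proof -
    \<comment> \<open>The surplus of \<open>m\<close> over its threshold against \<open>j\<close> is
      the unnormalized sum in coordinate \<open>j\<close>. Division by \<open>sqrt n\<close>
      preserves its sign, and the strict threshold corresponds to the open orthant.\<close>
    have diff: "real (card {i \<in> {..<n}. v i None < v i (Some j)}) - \<alpha> $ j * real n = (\<Sum>i<n. y (v i) $ j)" for j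
    proof -
      have "real (card {i \<in> {..<n}. v i None < v i (Some j)}) = (\<Sum>i<n. 1 - adv_vec (v i) $ j)"
        by (rule card_voters_eq_sum) (use v in auto)
      then show ?thesis by (simp add: y_def \<beta>_def sum_subtractf sum.distrib algebra_simps)
    qed
    have "\<alpha> $ j * real n < real (card {i \<in> {..<n}. v i None < v i (Some j)}) \<longleftrightarrow> 0 < (\<Sum>i<n. y (v i) $ j)" for j
      using diff [of j] by linarith
    moreover have "?S n v $ j = (\<Sum>i<n. y (v i) $ j) / sqrt n" for j
      by (simp add: finite_iid_vector.clt_sum_def [OF voters])
    ultimately show ?thesis
      using n by (simp add: alpha_winner_def zero_less_divide_iff)
  qed
  have prob: "iid_expectation rankings p n (\<lambda>v. of_bool (\<forall>j. 0 < ?S n v $ j)) = prob_winner p \<alpha> n"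
    if "n > 0" for n
    unfolding prob_winner_def iid_expectation_def by (rule sum.cong) (simp_all add: winner [OF that] of_bool_def)
  have "eventually (\<lambda>n. iid_expectation rankings p n (\<lambda>v. of_bool (\<forall>j. 0 < ?S n v $ j)) = prob_winner p \<alpha> n) sequentially"
    using eventually_gt_at_top [of 0] by eventually_elim (rule prob)
  with finite_iid_vector.clt_orthant [OF voters]
  have "(\<lambda>n. prob_winner p \<alpha> n) \<longlonglongrightarrow> measure std_gaussian {v. \<forall>j. 0 < (A *v v) $ j}"
    by (rule Lim_transform_eventually)
  then have "(\<lambda>n. prob_winner p \<alpha> n) \<longlonglongrightarrow> measure std_gaussian {v. A *v v \<in> {u. \<forall>j. 0 < u $ j}}"
    by (simp only: mem_Collect_eq)
  moreover have "{u. \<forall>j. 0 < u $ j} \<in> sets (borel :: (real^'n) measure)"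
  proof -
    have "open {u :: real^'n. \<forall>j. 0 < u $ j}"
      unfolding Collect_all_eq by (intro open_INT open_Collect_less continuous_intros ballI) simp
    then show ?thesis by simp
  qed
  ultimately show ?thesis
    unfolding Let_def H_def [symmetric] A(2) by (simp only: std_gaussian_linear_image [OF A(1)])
qed

end
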